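(* Let $n\ge2$. A vector $(f_1,\ldots,f_{n-1})$ of positive integers equals $(e_1(A),\ldots,e_{n-1}(A))$ for some basic oscillatory $n\times n$ matrix $A$ if and only if $$f_k\le\max\{k,n-k\}\quad(1\le k<n),$$ $$|f_{k+1}-f_k|\le1\quad(1\le k<n-1),$$ $$f_k+f_{n-k}\ge n\quad(1\le k<n).$$
   Context: All matrices are real. A matrix is totally nonnegative (TN) if all its minors are nonnegative and totally positive (TP) if all its minors are positive. A square TN matrix is oscillatory if some positive integer power of it is TP. For an oscillatory matrix $A$ of order $n$ and $1\le k\le n$, $e_k(A)=\min\{m\ge1:\text{all minors of order }k\text{ of }A^m\text{ are positive}\}$. Let $x_i(a)=I+aE_{i,i+1}$ for $1\le i<n$, where $E_{ij}$ has a single nonzero entry one in position $(i,j)$. Every nonsingular TN matrix factors as $A=U_-^T\Delta U_+$ with $\Delta$ diagonal with positive diagonal entries and each of $U_-,U_+$ a product of factors $x_i(a)$, $a\ge0$ (zero parameters giving identity factors), with indices in the fixed order $(n-1);\ (n-2,n-1);\ \ldots;\ (1,2,\ldots,n-1)$. A nonsingular TN matrix is basic oscillatory if it admits such a factorization in which, in each of $U_-$ and $U_+$, each index $1,\ldots,n-1$ has exactly one positive parameter. No symmetry is assumed. *)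

theory Defs
  imports
    "Jordan_Normal_Form.Determinant"
    "Jordan_Normal_Form.DL_Submatrix"
begin

definition minors :: "nat \<Rightarrow> real mat \<Rightarrow> real set" where
  "minors k A = {det (submatrix A I J) | I J.
     I \<subseteq> {..<dim_row A} \<and> J \<subseteq> {..<dim_col A} \<and> card I = k \<and> card J = k}"

definition totally_nonneg :: "real mat \<Rightarrow> bool" where
  "totally_nonneg A \<longleftrightarrow> (\<forall>k. \<forall>x\<in>minors k A. 0 \<le> x)"

(* The set is nonempty whenever A is oscillatory, and Inf is then its minimum.
   If the set is empty (A not oscillatory), the value is 0, which is never the minimum of such a set. *)
definition minor_exponent :: "nat \<Rightarrow> real mat \<Rightarrow> nat" where
  "minor_exponent k A = Inf {m. 1 \<le> m \<and> (\<forall>x\<in>minors k (A ^\<^sub>m m). 0 < x)}"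

(* x_i(a) = I + a E_{i,i+1} with i counted from 1; matrix entries are counted from 0,
   so E_{i,i+1} has its one in position (i - 1, i). *)
definition elem_bidiag :: "nat \<Rightarrow> nat \<Rightarrow> real \<Rightarrow> real mat" where
  "elem_bidiag n i a = 1\<^sub>m n + mat n n (\<lambda>(r, c). if r = i - 1 \<and> c = i then a else 0)"

(* Lists (s, i) with index sequence (n-1); (n-2, n-1); ...; (1, 2, ..., n-1), where s is the
   first index of the block containing the position. *)
definition factor_positions :: "nat \<Rightarrow> (nat \<times> nat) list" where
  "factor_positions n = concat (map (\<lambda>s. map (Pair s) [s..<n]) (rev [1..<n]))"

(* a s i is the parameter of the factor with index i in the block (s, ..., n-1). *)
definition factor_product :: "nat \<Rightarrow> (nat \<Rightarrow> nat \<Rightarrow> real) \<Rightarrow> real mat" where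
  "factor_product n a =
     foldr (\<lambda>(s, i) M. elem_bidiag n i (a s i) * M) (factor_positions n) (1\<^sub>m n)"

definition basic_params :: "nat \<Rightarrow> (nat \<Rightarrow> nat \<Rightarrow> real) \<Rightarrow> bool" where
  "basic_params n a \<longleftrightarrow>
     (\<forall>(s, i)\<in>set (factor_positions n). 0 \<le> a s i) \<and>
     (\<forall>i\<in>{1..<n}. \<exists>!s. (s, i) \<in> set (factor_positions n) \<and> 0 < a s i)"

definition basic_oscillatory :: "nat \<Rightarrow> real mat \<Rightarrow> bool" where
  "basic_oscillatory n A \<longleftrightarrow>
     A \<in> carrier_mat n n \<and> invertible_mat A \<and> totally_nonneg A \<and>
     (\<exists>a b d. basic_params n a \<and> basic_params n b \<and> (\<forall>i<n. 0 < d i) \<and>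
        A = transpose_mat (factor_product n a) * mat_diag n d * factor_product n b)"

end

theory Submission
  imports Defs
begin

text \<open>By repeated row expansion, a minor of order \<open>k\<close> of a power of a basic oscillatory matrix is positive
  iff \<open>k\<close> particles on a line with exclusion can hop from the row set to the column set, where the factors
  of the power prescribe the order in which edges are offered. Path families are closed under
  componentwise maximum and minimum, so only the paths between the lowest and the highest configuration
  matter, and there only the hops in one direction are useful.

  An upward pass, which offers every edge once, is encoded by a function \<open>g\<close> on the edges \<open>1, \<dots>, n - 1\<close>
  whose increments are \<open>0\<close> or \<open>1\<close>, depending on which of two consecutive edges comes first. The number
  of passes that the \<open>k\<close> lowest particles need to reach the top is exactly \<open>r k = k + g (n - k) - g k\<close>,
  and \<open>e\<^sub>k\<close> is the maximum of the two values that belong to \<open>U\<^sub>-\<close> and \<open>U\<^sub>+\<close>. The sequences \<open>r\<close> arising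
  in this way are those with \<open>\<bar>r (k + 1) - r k\<bar> \<le> 1\<close> and \<open>r k + r (n - k) = n\<close>; a prescribed \<open>f\<close> is the
  maximum of two of them, one equal to \<open>f\<close> for \<open>k \<le> n / 2\<close> and the other equal to \<open>f\<close> for \<open>k \<ge> n / 2\<close>.\<close>

section \<open>Configurations of particles and their extreme positions\<close>

definition config :: "nat \<Rightarrow> nat \<Rightarrow> (nat \<Rightarrow> nat) \<Rightarrow> bool" where
  "config n k p \<longleftrightarrow> strict_mono_on {..<k} p \<and> p ` {..<k} \<subseteq> {..<n}"

lemma config_less: "config n k p \<Longrightarrow> i < j \<Longrightarrow> j < k \<Longrightarrow> p i < p j"
  by (auto simp: config_def strict_mono_on_def)

lemma config_bound: "config n k p \<Longrightarrow> j < k \<Longrightarrow> p j < n"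
  by (auto simp: config_def)

lemma configI: "(\<And>i j. i < j \<Longrightarrow> j < k \<Longrightarrow> p i < p j) \<Longrightarrow> (\<And>j. j < k \<Longrightarrow> p j < n) \<Longrightarrow> config n k p"
  by (auto simp: config_def strict_mono_on_def)

lemma config_inj: "config n k p \<Longrightarrow> i < k \<Longrightarrow> j < k \<Longrightarrow> p i = p j \<longleftrightarrow> i = j"
  by (metis config_less less_irrefl linorder_neqE_nat)

text \<open>Only the values of \<open>p\<close> below \<open>k\<close> describe the configuration;
  this lemma and its analogues for paths let the remaining values be arbitrary.\<close>

lemma config_cong: "(\<And>j. j < k \<Longrightarrow> p j = q j) \<Longrightarrow> config n k p \<longleftrightarrow> config n k q"
  by (auto simp: config_def strict_mono_on_def image_subset_iff)

lemma config_bottom: "k \<le> n \<Longrightarrow> config n k (\<lambda>j. j)"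
  by (auto simp: config_def strict_mono_on_def)

lemma config_top: "k \<le> n \<Longrightarrow> config n k (\<lambda>j. n - k + j)"
  by (auto simp: config_def strict_mono_on_def)

lemma config_max:
  assumes "config n k p" "config n k q"
  shows "config n k (\<lambda>j. max (p j) (q j))"
proof (rule configI)
  fix i j assume "i < j" "j < k"
  then have "p i < p j" "q i < q j"
    using config_less assms by blast+
  then show "max (p i) (q i) < max (p j) (q j)" by linarith
qed (use assms in \<open>simp add: config_bound\<close>)

lemma config_min:
  assumes "config n k p" "config n k q"
  shows "config n k (\<lambda>j. min (p j) (q j))"
proof (rule configI)
  fix i j assume "i < j" "j < k"
  then have "p i < p j" "q i < q j"
    using config_less assms by blast+
  then show "min (p i) (q i) < min (p j) (q j)" by linarith
qed (use assms in \<open>simp add: config_bound min_less_iff_disj\<close>)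

lemma config_ge_bottom:
  assumes "config n k p" "j < k"
  shows "j \<le> p j"
  using assms(2)
proof (induction j)
  case (Suc j)
  then show ?case using config_less[OF assms(1), of j "Suc j"] by simp
qed simp

text \<open>Positions grow by at least one per particle, so particle \<open>j\<close> lies at least
  \<open>k - 1 - j\<close> below the last one, whose position is below \<open>n\<close>.\<close>

lemma config_le_top:
  assumes "config n k p" "j < k"
  shows "p j + k \<le> n + j"
proof -
  have "p j + i \<le> p (j + i)" if "j + i < k" for i
    using that
  proof (induction i)
    case (Suc i)
    then show ?case using config_less[OF assms(1), of "j + i" "j + Suc i"] by simp
  qed simp
  from this[of "k - 1 - j"] assms show ?thesis
    using config_bound[OF assms(1), of "k - 1"] by (simp)
qed

section \<open>Minors indexed by sequences and their row expansion\<close>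

definition seq_minor :: "nat \<Rightarrow> real mat \<Rightarrow> (nat \<Rightarrow> nat) \<Rightarrow> (nat \<Rightarrow> nat) \<Rightarrow> real" where
  "seq_minor k M p q = det (mat k k (\<lambda>(i, j). M $$ (p i, q j)))"

lemma seq_minor_cong:
  "(\<And>i j. i < k \<Longrightarrow> j < k \<Longrightarrow> M $$ (p i, q j) = M' $$ (p' i, q' j)) \<Longrightarrow>
    seq_minor k M p q = seq_minor k M' p' q'"
  unfolding seq_minor_def by (rule arg_cong[of _ _ det], rule cong_mat) auto

text \<open>\<open>p j\<close> has exactly \<open>j\<close> smaller elements in the image, and
  \<open>pick\<close> enumerates a set in increasing order.\<close>

lemma pick_image_eq:
  assumes "config n k p" "j < k"
  shows "pick (p ` {..<k}) j = p j"
proof -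
  have "{a \<in> p ` {..<k}. a < p j} = p ` {..<j}"
    using config_less[OF assms(1)] assms(2)
    by (auto, metis imageI lessThan_iff linorder_neqE_nat order_less_asym order_less_irrefl)
  moreover have "card (p ` {..<j}) = j"
    using assms(2) by (subst card_image) (auto simp: inj_on_def config_inj[OF assms(1)])
  ultimately show ?thesis
    using pick_card_in_set[of "p j" "p ` {..<k}"] assms(2) by simp
qed

text \<open>Index sets of size \<open>k\<close> and configurations correspond by \<open>pick\<close>
  in one direction and by taking the image in the other.\<close>

lemma minors_eq:
  assumes "X \<in> carrier_mat n n"
  shows "minors k X = {seq_minor k X p q | p q. config n k p \<and> config n k q}" (is "_ = ?R")
proof -
  have sub: "det (submatrix X I J) = seq_minor k X (pick I) (pick J)"
    if "I \<subseteq> {..<n}" "J \<subseteq> {..<n}" "card I = k" "card J = k" for I J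
  proof -
    have "{i. i < n \<and> i \<in> I} = I" "{i. i < n \<and> i \<in> J} = J" using that by auto
    then show ?thesis using assms that(3,4) by (simp add: submatrix_def seq_minor_def)
  qed
  have pick: "config n k (pick I)" if "I \<subseteq> {..<n}" "card I = k" for I
  proof (rule configI)
    show "pick I i < pick I j" if "i < j" "j < k" for i j
      using pick_mono[of j I i] that \<open>card I = k\<close> by simp
    show "pick I j < n" if "j < k" for j
      using pick_in_set_le[of j I] that \<open>card I = k\<close> \<open>I \<subseteq> {..<n}\<close> by auto
  qed
  show ?thesis
  proof (intro equalityI subsetI)
    fix x assume "x \<in> minors k X"
    then obtain I J where IJ: "x = det (submatrix X I J)"
      "I \<subseteq> {..<n}" "J \<subseteq> {..<n}" "card I = k" "card J = k"
      using assms by (auto simp: minors_def)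
    then show "x \<in> ?R"
      using sub[OF IJ(2-5)] pick[OF IJ(2,4)] pick[OF IJ(3,5)] by blast
  next
    fix x assume "x \<in> ?R"
    then obtain p q where pq: "x = seq_minor k X p q" "config n k p" "config n k q" by auto
    have card: "card (p ` {..<k}) = k" if "config n k p" for p
      by (subst card_image) (auto simp: inj_on_def config_inj[OF that])
    have subset: "p ` {..<k} \<subseteq> {..<n}" if "config n k p" for p
      using that by (simp add: config_def)
    have "x = seq_minor k X (pick (p ` {..<k})) (pick (q ` {..<k}))"
      unfolding pq(1) by (rule seq_minor_cong) (simp add: pick_image_eq[OF pq(2)] pick_image_eq[OF pq(3)])
    also have "\<dots> = det (submatrix X (p ` {..<k}) (q ` {..<k}))"
      using sub[OF subset subset card card] pq by simp
    finally show "x \<in> minors k X"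
      using assms subset[OF pq(2)] subset[OF pq(3)] card[OF pq(2)] card[OF pq(3)]
      unfolding minors_def by blast
  qed
qed

lemma seq_minor_leibniz:
  "seq_minor k M p q =
    (\<Sum>\<pi> | \<pi> permutes {0..<k}. signof \<pi> * (\<Prod>i = 0..<k. M $$ (p i, q (\<pi> i))))"
  unfolding seq_minor_def
  by (subst det_def'[of _ k]) (auto intro!: sum.cong prod.cong simp: permutes_in_image)

text \<open>Every Leibniz product has exactly one factor from row \<open>j\<close>. The new index
  sequence \<open>p(j := s)\<close> may repeat a value or lose its order, which is why
  \<open>seq_minor\<close> takes arbitrary index functions.\<close>

lemma seq_minor_row_add:
  assumes "j < k"
    and row: "\<And>c. c < k \<Longrightarrow> X $$ (p j, q c) = M $$ (p j, q c) + a * M $$ (s, q c)"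
    and rest: "\<And>i c. i < k \<Longrightarrow> i \<noteq> j \<Longrightarrow> c < k \<Longrightarrow> X $$ (p i, q c) = M $$ (p i, q c)"
  shows "seq_minor k X p q = seq_minor k M p q + a * seq_minor k M (p(j := s)) q"
proof -
  have "(\<Prod>i = 0..<k. X $$ (p i, q (\<pi> i))) =
      (\<Prod>i = 0..<k. M $$ (p i, q (\<pi> i))) + a * (\<Prod>i = 0..<k. M $$ ((p(j := s)) i, q (\<pi> i)))"
    if \<pi>: "\<pi> permutes {0..<k}" for \<pi>
  proof -
    have lt: "\<pi> i < k" if "i < k" for i using permutes_in_image[OF \<pi>, of i] that by simp
    have split: "prod h {0..<k} = h j * prod h ({0..<k} - {j})" for h :: "nat \<Rightarrow> real"
      using assms(1) by (subst prod.remove[of _ j]) auto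
    have 1: "(\<Prod>i\<in>{0..<k} - {j}. X $$ (p i, q (\<pi> i))) = (\<Prod>i\<in>{0..<k} - {j}. M $$ (p i, q (\<pi> i)))"
      by (rule prod.cong) (auto simp: rest lt)
    have 2: "(\<Prod>i\<in>{0..<k} - {j}. M $$ ((p(j := s)) i, q (\<pi> i))) =
        (\<Prod>i\<in>{0..<k} - {j}. M $$ (p i, q (\<pi> i)))"
      by (rule prod.cong) auto
    show ?thesis
      unfolding split 1 2 using row[OF lt[OF assms(1)]] by (simp add: algebra_simps)
  qed
  then show ?thesis
    unfolding seq_minor_leibniz sum_distrib_left sum.distrib[symmetric]
    by (intro sum.cong) (auto simp: algebra_simps)
qed

lemma seq_minor_row_scale:
  assumes "\<And>i c. i < k \<Longrightarrow> c < k \<Longrightarrow> X $$ (p i, q c) = d (p i) * M $$ (p i, q c)"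
  shows "seq_minor k X p q = (\<Prod>i = 0..<k. d (p i)) * seq_minor k M p q"
proof -
  have "(\<Prod>i = 0..<k. X $$ (p i, q (\<pi> i))) =
      (\<Prod>i = 0..<k. d (p i)) * (\<Prod>i = 0..<k. M $$ (p i, q (\<pi> i)))"
    if \<pi>: "\<pi> permutes {0..<k}" for \<pi>
    unfolding prod.distrib[symmetric]
    by (rule prod.cong) (use permutes_in_image[OF \<pi>] in \<open>auto simp: assms\<close>)
  then show ?thesis
    unfolding seq_minor_leibniz sum_distrib_left
    by (intro sum.cong) (auto simp: algebra_simps)
qed

lemma seq_minor_equal_rows:
  assumes "i < k" "j < k" "i \<noteq> j" "p i = p j"
  shows "seq_minor k M p q = 0"
  unfolding seq_minor_def
  by (rule det_identical_rows[of _ k i j]) (use assms in \<open>auto intro!: eq_vecI\<close>)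

lemma seq_minor_zero_row:
  assumes "i < k" "\<And>c. c < k \<Longrightarrow> M $$ (p i, q c) = 0"
  shows "seq_minor k M p q = 0"
  unfolding seq_minor_leibniz
proof (rule sum.neutral, safe)
  fix \<pi> assume "\<pi> permutes {0..<k}"
  then have "\<pi> i < k"
    using permutes_in_image[of \<pi> "{0..<k}" i] assms(1) by simp
  then have "(\<Prod>i = 0..<k. M $$ (p i, q (\<pi> i))) = 0"
    using assms by (intro prod_zero) (auto intro!: bexI[of _ i])
  then show "signof \<pi> * (\<Prod>i = 0..<k. M $$ (p i, q (\<pi> i))) = 0" by simp
qed

section \<open>Hops, paths and the positivity of minors\<close>

text \<open>A move \<open>(r, s)\<close> lets a particle hop from \<open>r\<close> to \<open>s\<close>, or leaves the configuration alone.
  Strict monotonicity of both configurations ensures that at most one particle hops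
  and that it hops to a free site.\<close>

definition hop :: "nat \<Rightarrow> nat \<Rightarrow> nat \<times> nat \<Rightarrow> (nat \<Rightarrow> nat) \<Rightarrow> (nat \<Rightarrow> nat) \<Rightarrow> bool" where
  "hop n k mv p p' \<longleftrightarrow> config n k p' \<and> (\<forall>j<k. p' j = p j \<or> p j = fst mv \<and> p' j = snd mv)"

fun path :: "nat \<Rightarrow> nat \<Rightarrow> (nat \<times> nat) list \<Rightarrow> (nat \<Rightarrow> nat) \<Rightarrow> (nat \<Rightarrow> nat) \<Rightarrow> bool" where
  "path n k [] p q \<longleftrightarrow> (\<forall>j<k. p j = q j)"
| "path n k (mv # w) p q \<longleftrightarrow> (\<exists>p'. hop n k mv p p' \<and> path n k w p' q)"

lemma path_cong:
  assumes "path n k w p q" and eq: "\<And>j. j < k \<Longrightarrow> p j = p' j"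
  shows "path n k w p' q"
proof (cases w)
  case Nil
  then show ?thesis using assms(1) by (simp add: eq)
next
  case (Cons mv w')
  have "hop n k mv p p'' \<longleftrightarrow> hop n k mv p' p''" for p''
    by (simp add: hop_def eq cong: conj_cong imp_cong)
  then show ?thesis using assms(1) Cons by simp
qed

definition adjacent :: "nat \<Rightarrow> nat \<times> nat \<Rightarrow> bool" where
  "adjacent n mv \<longleftrightarrow> fst mv < n \<and> snd mv < n \<and> (fst mv = Suc (snd mv) \<or> snd mv = Suc (fst mv))"

text \<open>Nonnegativity belongs to the invariant because it excludes cancellation: a sum of two
  such minors is positive exactly when one of them is.\<close>

definition represents :: "nat \<Rightarrow> real mat \<Rightarrow> (nat \<times> nat) list \<Rightarrow> bool" where
  "represents n M w \<longleftrightarrow> M \<in> carrier_mat n n \<and>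
    (\<forall>k p q. config n k p \<longrightarrow> config n k q \<longrightarrow>
      0 \<le> seq_minor k M p q \<and> (0 < seq_minor k M p q \<longleftrightarrow> path n k w p q))"

lemma represents_carrier: "represents n M w \<Longrightarrow> M \<in> carrier_mat n n"
  by (simp add: represents_def)

lemma represents_one: "represents n (1\<^sub>m n) []"
  unfolding represents_def
proof (intro conjI allI impI)
  fix k p q
  assume p: "config n k p" and q: "config n k q"
  have "seq_minor k (1\<^sub>m n) p q = (if \<forall>j<k. p j = q j then 1 else 0)"
  proof (cases "\<forall>j<k. p j = q j")
    case True
    have "mat k k (\<lambda>(i, j). 1\<^sub>m n $$ (p i, q j)) = (1\<^sub>m k :: real mat)"
      by (intro eq_matI) (simp_all add: True config_bound[OF q] config_inj[OF q])
    then show ?thesis using True by (simp add: seq_minor_def)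
  next
    case False
    \<comment> \<open>Distinct configurations have distinct images of equal size, so some row index
      does not occur among the column indices and its row vanishes.\<close>
    have "\<exists>i<k. \<forall>c<k. p i \<noteq> q c"
    proof (rule ccontr)
      assume "\<not> ?thesis"
      then have "p ` {..<k} \<subseteq> q ` {..<k}" by auto
      moreover have "card (p ` {..<k}) = k" "card (q ` {..<k}) = k"
        by (simp_all add: card_image inj_on_def config_inj[OF p] config_inj[OF q])
      ultimately have "p ` {..<k} = q ` {..<k}"
        by (simp add: card_subset_eq)
      then have "p j = q j" if "j < k" for j
        using pick_image_eq[OF p that] pick_image_eq[OF q that] by simp
      then show False using False by blast
    qed
    then obtain i where i: "i < k" "\<And>c. c < k \<Longrightarrow> p i \<noteq> q c" by blast
    have "1\<^sub>m n $$ (p i, q c) = (0 :: real)" if "c < k" for c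
      using i(2)[OF that] config_bound[OF p i(1)] config_bound[OF q that] by simp
    then have "seq_minor k (1\<^sub>m n) p q = 0"
      by (rule seq_minor_zero_row[OF i(1)])
    then show ?thesis using False by simp
  qed
  then show "0 \<le> seq_minor k (1\<^sub>m n) p q"
    and "0 < seq_minor k (1\<^sub>m n) p q \<longleftrightarrow> path n k [] p q"
    by simp_all
qed simp

lemma represents_diag:
  assumes "represents n M w" "\<And>i. i < n \<Longrightarrow> 0 < d i"
  shows "represents n (mat_diag n d * M) w"
  unfolding represents_def
proof (intro conjI allI impI)
  note M = represents_carrier[OF assms(1)]
  then show "mat_diag n d * M \<in> carrier_mat n n" by (rule mult_carrier_mat[OF mat_diag_dim])
  fix k p q
  assume p: "config n k p" and q: "config n k q"
  have "seq_minor k (mat_diag n d * M) p q = (\<Prod>i = 0..<k. d (p i)) * seq_minor k M p q"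
    by (rule seq_minor_row_scale)
      (simp add: mat_diag_mult_left[OF M] config_bound[OF p] config_bound[OF q])
  moreover have "0 < (\<Prod>i = 0..<k. d (p i))"
    by (intro prod_pos) (auto simp: assms(2) config_bound[OF p])
  ultimately show "0 \<le> seq_minor k (mat_diag n d * M) p q"
    and "0 < seq_minor k (mat_diag n d * M) p q \<longleftrightarrow> path n k w p q"
    using assms(1) p q by (auto simp: represents_def zero_less_mult_iff)
qed

text \<open>No site lies between neighbours, so a hop to a free neighbouring site cannot overtake
  another particle.\<close>

lemma config_hop:
  assumes "config n k p" "adjacent n (p j, s)" "j < k" "s \<notin> p ` {..<k}"
  shows "config n k (p(j := s))"
proof (rule configI)
  fix i l assume il: "i < l" "l < k"
  have "p i \<noteq> s" "p l \<noteq> s" using assms(4) il by auto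
  then show "(p(j := s)) i < (p(j := s)) l"
    using config_less[OF assms(1) il] assms(2) il by (auto simp: adjacent_def)
qed (use assms in \<open>auto simp: adjacent_def config_bound\<close>)

text \<open>Left multiplication adds \<open>a\<close> times row \<open>s\<close> to row
  \<open>r\<close>. Linearity in that row splits a minor into a term where the particle stays at
  \<open>r\<close> and a term where it has hopped to \<open>s\<close>.\<close>

lemma represents_addrow:
  assumes "represents n M w" "adjacent n (r, s)" "0 < a"
  shows "represents n (addrow_mat n a r s * M) ((r, s) # w)"
  unfolding represents_def
proof (intro conjI allI impI)
  note M = represents_carrier[OF assms(1)]
  then show "addrow_mat n a r s * M \<in> carrier_mat n n"
    by (rule mult_carrier_mat[OF addrow_mat_carrier])
  fix k p q
  assume p: "config n k p" and q: "config n k q"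
  have IH: "0 \<le> seq_minor k M p' q \<and> (0 < seq_minor k M p' q \<longleftrightarrow> path n k w p' q)"
    if "config n k p'" for p'
    using assms(1) that q by (simp add: represents_def)
  have rs: "r < n" "s < n" using assms(2) by (auto simp: adjacent_def)
  have entry: "(addrow_mat n a r s * M) $$ (x, y) =
      M $$ (x, y) + (if x = r then a * M $$ (s, y) else 0)" if "x < n" "y < n" for x y
    unfolding addrow_mat[OF M rs(2), symmetric] using that M by auto
  show "0 \<le> seq_minor k (addrow_mat n a r s * M) p q"
    and "0 < seq_minor k (addrow_mat n a r s * M) p q \<longleftrightarrow> path n k ((r, s) # w) p q"
  proof -
    have expand: "seq_minor k (addrow_mat n a r s * M) p q =
        seq_minor k M p q + a * seq_minor k M (p(j := s)) q" if j: "j < k" "p j = r" for j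
    proof (rule seq_minor_row_add[OF j(1)])
      fix c assume c: "c < k"
      show "(addrow_mat n a r s * M) $$ (p j, q c) = M $$ (p j, q c) + a * M $$ (s, q c)"
        using entry[OF rs(1) config_bound[OF q c]] j(2) by simp
      fix i assume i: "i < k" "i \<noteq> j"
      then have "p i \<noteq> r" using config_inj[OF p i(1) j(1)] j(2) by simp
      then show "(addrow_mat n a r s * M) $$ (p i, q c) = M $$ (p i, q c)"
        using entry[OF config_bound[OF p i(1)] config_bound[OF q c]] by simp
    qed
    have stay: "path n k w p q \<Longrightarrow> path n k ((r, s) # w) p q"
      using p by (auto simp: hop_def)
    consider (none) "r \<notin> p ` {..<k}" | (blocked) j where "j < k" "p j = r" "s \<in> p ` {..<k}"
      | (free) j where "j < k" "p j = r" "s \<notin> p ` {..<k}" by (metis imageE lessThan_iff)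
    then have "0 \<le> seq_minor k (addrow_mat n a r s * M) p q \<and>
      (0 < seq_minor k (addrow_mat n a r s * M) p q \<longleftrightarrow> path n k ((r, s) # w) p q)"
    proof cases
      case none
      then have "p i \<noteq> r" if "i < k" for i using that by auto
      then have "seq_minor k (addrow_mat n a r s * M) p q = seq_minor k M p q"
        by (intro seq_minor_cong) (simp add: entry config_bound[OF p] config_bound[OF q])
      moreover have "path n k w p q" if "path n k ((r, s) # w) p q"
        using that none by (auto simp: hop_def elim!: path_cong)
      ultimately show ?thesis using IH[OF p] stay by auto
    next
      case (blocked j)
      then obtain l where l: "l < k" "p l = s" by auto
      have "j \<noteq> l" using l blocked assms(2) by (auto simp: adjacent_def)
      note expand[OF blocked(1,2)]
      also have "seq_minor k M (p(j := s)) q = 0"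
        using l blocked \<open>j \<noteq> l\<close> by (intro seq_minor_equal_rows[of j _ l]) auto
      finally have "seq_minor k (addrow_mat n a r s * M) p q = seq_minor k M p q" by simp
      \<comment> \<open>Particle \<open>l\<close> stays on \<open>s\<close>, so a hop of
        \<open>j\<close> would put two particles on one site.\<close>
      moreover have "path n k w p q" if path: "path n k ((r, s) # w) p q"
      proof -
        obtain p' where p': "hop n k (r, s) p p'" "path n k w p' q" using path by auto
        have "p' i = p i" if "i < k" for i
        proof (rule ccontr)
          assume "p' i \<noteq> p i"
          then have "p i = r" "p' i = s" using p'(1) that by (auto simp: hop_def)
          then have "i = j" using blocked that by (metis config_inj[OF p])
          have "p' l = s" using p'(1) l by (auto simp: hop_def)
          then show False
            using p'(1) \<open>p' i = s\<close> \<open>i = j\<close> \<open>j \<noteq> l\<close> l blocked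
            by (metis config_inj hop_def)
        qed
        then show ?thesis using p'(2) by (elim path_cong) auto
      qed
      ultimately show ?thesis using IH[OF p] stay by auto
    next
      case (free j)
      note expand[OF free(1,2)]
      moreover have c: "config n k (p(j := s))"
        using config_hop[OF p, of j s] free assms(2) by auto
      moreover have "path n k ((r, s) # w) p q \<longleftrightarrow> path n k w p q \<or> path n k w (p(j := s)) q"
      proof
        assume "path n k ((r, s) # w) p q"
        then obtain p' where p': "hop n k (r, s) p p'" "path n k w p' q" by auto
        have other: "p' i = p i" if "i < k" "i \<noteq> j" for i
          using p'(1) that free config_inj[OF p, of i j] by (auto simp: hop_def)
        consider "p' j = p j" | "p' j = s" using p'(1) free by (auto simp: hop_def)
        then show "path n k w p q \<or> path n k w (p(j := s)) q"
        proof cases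
          case 1
          then have "path n k w p q" using p'(2) other by (elim path_cong) metis
          then show ?thesis ..
        next
          case 2
          then have "path n k w (p(j := s)) q" using p'(2) other by (elim path_cong) auto
          then show ?thesis ..
        qed
      next
        assume "path n k w p q \<or> path n k w (p(j := s)) q"
        moreover have "hop n k (r, s) p (p(j := s))"
          using c free(2) by (simp add: hop_def)
        ultimately show "path n k ((r, s) # w) p q"
          using stay path.simps(2) by blast
      qed
      moreover have "0 \<le> x + a * y \<and> (0 < x + a * y \<longleftrightarrow> 0 < x \<or> 0 < y)"
        if "0 \<le> x" "0 \<le> y" for x y :: real
        using that assms(3) by (cases "y = 0") (auto simp: add_nonneg_pos)
      ultimately show ?thesis using IH[OF p] IH[OF c] by metis
    qed
    then show "0 \<le> seq_minor k (addrow_mat n a r s * M) p q"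
      and "0 < seq_minor k (addrow_mat n a r s * M) p q \<longleftrightarrow> path n k ((r, s) # w) p q"
      by auto
  qed
qed

section \<open>Concatenation, reversal and lattice structure of paths\<close>

lemma path_config: "path n k w p q \<Longrightarrow> config n k p \<Longrightarrow> config n k q"
proof (induction w arbitrary: p)
  case Nil
  then show ?case using config_cong[of k p q n] by simp
next
  case (Cons mv w)
  then show ?case by (auto simp: hop_def)
qed

lemma path_cong_target:
  "path n k w p q \<Longrightarrow> (\<And>j. j < k \<Longrightarrow> q j = q' j) \<Longrightarrow> path n k w p q'"
  by (induction w arbitrary: p) auto

lemma hop_refl: "config n k p \<Longrightarrow> hop n k mv p p"
  by (simp add: hop_def)

lemma path_refl: "config n k p \<Longrightarrow> path n k w p p"
  by (induction w) (auto intro: hop_refl)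

lemma path_append:
  "path n k (w @ w') p q \<longleftrightarrow> (\<exists>p'. path n k w p p' \<and> path n k w' p' q)"
proof (induction w arbitrary: p)
  case Nil
  have "path n k w' p q" if "\<forall>j<k. p j = p' j" "path n k w' p' q" for p'
    using that(2) by (rule path_cong) (simp add: that(1))
  then show ?case by auto
next
  case (Cons mv w)
  then show ?case by auto
qed

lemma hop_swap: "config n k p \<Longrightarrow> hop n k mv p p' \<Longrightarrow> hop n k (prod.swap mv) p' p"
  by (auto simp: hop_def)

text \<open>Every hop is undone by the swapped move. Since \<open>hop\<close> checks only its
  target, the start \<open>p\<close> has to be assumed a configuration.\<close>

lemma path_rev:
  "config n k p \<Longrightarrow> path n k w p q \<Longrightarrow> path n k (rev (map prod.swap w)) q p"
proof (induction w arbitrary: p)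
  case (Cons mv w)
  then obtain p' where p': "hop n k mv p p'" "path n k w p' q" by auto
  then have "path n k (rev (map prod.swap w)) q p'"
    using Cons.IH by (simp add: hop_def)
  moreover have "path n k [prod.swap mv] p' p"
    using hop_swap[OF Cons.prems(1) p'(1)] by auto
  ultimately show ?case by (auto simp: path_append)
qed simp

text \<open>No position lies strictly between the two sites of the move, so the maximum of two
  positions either stays or makes the same hop.\<close>

lemma hop_max:
  assumes "adjacent n mv" "hop n k mv p p'" "hop n k mv q q'"
  shows "hop n k mv (\<lambda>j. max (p j) (q j)) (\<lambda>j. max (p' j) (q' j))"
proof -
  have "max (p' j) (q' j) = max (p j) (q j) \<or> max (p j) (q j) = fst mv \<and> max (p' j) (q' j) = snd mv"
    if "j < k" for j
  proof -
    have "p' j = p j \<or> p j = fst mv \<and> p' j = snd mv" "q' j = q j \<or> q j = fst mv \<and> q' j = snd mv"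
      using assms that by (auto simp: hop_def)
    then show ?thesis using assms(1) unfolding adjacent_def by linarith
  qed
  then show ?thesis using assms config_max by (simp add: hop_def)
qed

lemma hop_min:
  assumes "adjacent n mv" "hop n k mv p p'" "hop n k mv q q'"
  shows "hop n k mv (\<lambda>j. min (p j) (q j)) (\<lambda>j. min (p' j) (q' j))"
proof -
  have "min (p' j) (q' j) = min (p j) (q j) \<or> min (p j) (q j) = fst mv \<and> min (p' j) (q' j) = snd mv"
    if "j < k" for j
  proof -
    have "p' j = p j \<or> p j = fst mv \<and> p' j = snd mv" "q' j = q j \<or> q j = fst mv \<and> q' j = snd mv"
      using assms that by (auto simp: hop_def)
    then show ?thesis using assms(1) unfolding adjacent_def by linarith
  qed
  then show ?thesis using assms config_min by (simp add: hop_def)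
qed

lemma path_max:
  assumes "\<forall>mv\<in>set w. adjacent n mv" "path n k w p q" "path n k w p' q'"
  shows "path n k w (\<lambda>j. max (p j) (p' j)) (\<lambda>j. max (q j) (q' j))"
  using assms by (induction w arbitrary: p p') (auto, blast intro: hop_max)

lemma path_min:
  assumes "\<forall>mv\<in>set w. adjacent n mv" "path n k w p q" "path n k w p' q'"
  shows "path n k w (\<lambda>j. min (p j) (p' j)) (\<lambda>j. min (q j) (q' j))"
  using assms by (induction w arbitrary: p p') (auto, blast intro: hop_min)

text \<open>Paths are closed under componentwise maximum and minimum, and
  \<open>p \<longrightarrow> q\<close> is the join of \<open>p \<longrightarrow> bottom\<close> and \<open>bottom \<longrightarrow> q\<close>, which are in turn meets of constant
  paths with the two extreme ones.\<close>

lemma path_if_extreme_paths: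
  assumes adj: "\<forall>mv\<in>set w. adjacent n mv"
    and up: "path n k w (\<lambda>j. j) (\<lambda>j. n - k + j)"
    and down: "path n k w (\<lambda>j. n - k + j) (\<lambda>j. j)"
    and p: "config n k p" and q: "config n k q"
  shows "path n k w p q"
proof -
  note bounds = config_ge_bottom[OF p] config_ge_bottom[OF q] config_le_top[OF p] config_le_top[OF q]
  have "path n k w p (\<lambda>j. min (p j) j)"
    by (rule path_cong[OF path_min[OF adj path_refl[OF p] down]]) (use bounds in force)
  then have 1: "path n k w p (\<lambda>j. j)"
    by (rule path_cong_target) (use bounds in force)
  have "path n k w (\<lambda>j. j) (\<lambda>j. min (q j) (n - k + j))"
    by (rule path_cong[OF path_min[OF adj path_refl[OF q] up]]) (use bounds in force)
  then have 2: "path n k w (\<lambda>j. j) q"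
    by (rule path_cong_target) (use bounds in force)
  have "path n k w p (\<lambda>j. max j (q j))"
    by (rule path_cong[OF path_max[OF adj 1 2]]) (use bounds in force)
  then show ?thesis
    by (rule path_cong_target) (use bounds in force)
qed

section \<open>Move words of a pass and of a period\<close>

definition up_moves :: "nat list \<Rightarrow> (nat \<times> nat) list" where
  "up_moves u = map (\<lambda>i. (i - 1, i)) u"

text \<open>Transposing a product reverses its factors and turns each move around; \<open>u\<close>
  lists the indices as they stand before transposition.\<close>

definition down_moves :: "nat list \<Rightarrow> (nat \<times> nat) list" where
  "down_moves u = rev (map (\<lambda>i. (i, i - 1)) u)"

definition period_power :: "nat \<Rightarrow> nat list \<Rightarrow> nat list \<Rightarrow> (nat \<times> nat) list" where
  "period_power m v u = concat (replicate m (down_moves v @ up_moves u))"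

text \<open>Time reversal exchanges the two index lists, which reduces downward passages to upward
  ones.\<close>

lemma period_power_rev: "rev (map prod.swap (period_power m v u)) = period_power m u v"
  by (simp add: period_power_def map_concat rev_concat up_moves_def down_moves_def
      rev_map comp_def)

lemma period_power_adjacent:
  "set u = {1..<n} \<Longrightarrow> set v = {1..<n} \<Longrightarrow> mv \<in> set (period_power m v u) \<Longrightarrow> adjacent n mv"
  by (auto simp: period_power_def up_moves_def down_moves_def adjacent_def set_replicate_conv_if
      split: if_splits)

section \<open>Order of the indices within a pass, and heights\<close>

text \<open>\<open>g\<close> encodes which of the indices \<open>i\<close>, \<open>i + 1\<close> comes first in \<open>u\<close>: it is constant from \<open>i\<close> to \<open>i + 1\<close>
  if \<open>i\<close> does, and it increases by one otherwise.\<close>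

definition orders :: "nat \<Rightarrow> (nat \<Rightarrow> int) \<Rightarrow> nat list \<Rightarrow> bool" where
  "orders n g u \<longleftrightarrow> set u = {1..<n} \<and>
    sorted_wrt (\<lambda>x y. x \<noteq> y \<and> (y = Suc x \<longrightarrow> g y = g x) \<and> (x = Suc y \<longrightarrow> g x = g y + 1)) u"

definition unit_increments :: "nat \<Rightarrow> (nat \<Rightarrow> int) \<Rightarrow> bool" where
  "unit_increments n g \<longleftrightarrow> (\<forall>e. 1 \<le> e \<longrightarrow> Suc e < n \<longrightarrow> g e \<le> g (Suc e) \<and> g (Suc e) \<le> g e + 1)"

lemma unit_incrementsD:
  assumes "unit_increments n g" "1 \<le> a" "a \<le> b" "b < n"
  shows "g a \<le> g b \<and> g b \<le> g a + int (b - a)"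
  using assms(3,4)
proof (induction b rule: dec_induct)
  case (step b)
  then have "g b \<le> g (Suc b) \<and> g (Suc b) \<le> g b + 1"
    using assms(1,2) by (simp add: unit_increments_def)
  with step show ?case by (simp add: Suc_diff_le)
qed simp

text \<open>The height \<open>V e\<close> is the number of times that index \<open>e\<close> has been used, minus \<open>g e\<close>.
  The order in which indices are used makes heights vary like this at every moment.\<close>

definition level :: "nat \<Rightarrow> (nat \<Rightarrow> int) \<Rightarrow> bool" where
  "level n V \<longleftrightarrow> (\<forall>e. 1 \<le> e \<longrightarrow> Suc e < n \<longrightarrow> V (Suc e) \<le> V e \<and> V e \<le> V (Suc e) + 1)"

text \<open>\<open>m\<close> counts the completed passes, and \<open>xs\<close> holds the indices
  already used in the current one.\<close>

definition height :: "(nat \<Rightarrow> int) \<Rightarrow> int \<Rightarrow> nat list \<Rightarrow> nat \<Rightarrow> int" where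
  "height g m xs e = m - g e + (if e \<in> set xs then 1 else 0)"

lemma height_snoc:
  "i \<notin> set xs \<Longrightarrow> height g m (xs @ [i]) = (height g m xs)(i := height g m xs i + 1)"
  by (rule ext) (simp add: height_def)

text \<open>Only neighbours of which exactly one has been used matter. If that is \<open>e\<close>,
  then \<open>g\<close> agrees at both and the drop in height grows from 0 to 1; if it is
  \<open>e + 1\<close>, the drop shrinks from 1 to 0.\<close>

lemma level_height:
  assumes "unit_increments n g" "orders n g (xs @ ys)"
  shows "level n (height g m xs)"
  unfolding level_def
proof (intro allI impI)
  fix e assume e: "1 \<le> e" "Suc e < n"
  have d: "g e \<le> g (Suc e)" "g (Suc e) \<le> g e + 1"
    using assms(1) e by (auto simp: unit_increments_def)
  have mem: "e \<in> set xs \<or> e \<in> set ys" "Suc e \<in> set xs \<or> Suc e \<in> set ys"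
  proof -
    have "set xs \<union> set ys = {1..<n}" using assms(2) by (simp add: orders_def)
    then show "e \<in> set xs \<or> e \<in> set ys" "Suc e \<in> set xs \<or> Suc e \<in> set ys"
      using e by (metis Un_iff atLeastLessThan_iff le_SucI Suc_lessD)+
  qed
  have R: "(y = Suc x \<longrightarrow> g y = g x) \<and> (x = Suc y \<longrightarrow> g x = g y + 1)"
    if "x \<in> set xs" "y \<in> set ys" for x y
    using assms(2) that unfolding orders_def sorted_wrt_append by blast
  have "g (Suc e) = g e" if "e \<in> set xs" "Suc e \<notin> set xs"
    using R[of e "Suc e"] mem that by blast
  moreover have "g (Suc e) = g e + 1" if "Suc e \<in> set xs" "e \<notin> set xs"
    using R[of "Suc e" e] mem that by blast
  ultimately show "height g m xs (Suc e) \<le> height g m xs e \<and> height g m xs e \<le> height g m xs (Suc e) + 1"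
    using d by (cases "e \<in> set xs"; cases "Suc e \<in> set xs") (simp_all add: height_def)
qed

section \<open>Thresholds for the particles: an upper bound and a greedy schedule\<close>

text \<open>Particle \<open>j\<close> passes index \<open>e\<close> when it hops from \<open>e - 1\<close> to \<open>e\<close>; this requires \<open>V e + j\<close>
  to have reached the threshold \<open>c\<close>.\<close>

definition bounded_by :: "nat \<Rightarrow> int \<Rightarrow> (nat \<Rightarrow> int) \<Rightarrow> (nat \<Rightarrow> nat) \<Rightarrow> bool" where
  "bounded_by k c V p \<longleftrightarrow> (\<forall>j<k. \<forall>e. j < e \<longrightarrow> e \<le> p j \<longrightarrow> c \<le> V e + int j)"

text \<open>In the greedy schedule the threshold is also sufficient, so the heights prescribe the
  configuration. The range of \<open>e\<close> runs over the indices between the lowest site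
  \<open>j\<close> and the highest site \<open>n - k + j\<close> of particle
  \<open>j\<close>.\<close>

definition determined_by :: "nat \<Rightarrow> nat \<Rightarrow> int \<Rightarrow> (nat \<Rightarrow> int) \<Rightarrow> (nat \<Rightarrow> nat) \<Rightarrow> bool" where
  "determined_by n k c V p \<longleftrightarrow>
    (\<forall>j<k. \<forall>e. j < e \<longrightarrow> e \<le> n - k + j \<longrightarrow> (e \<le> p j \<longleftrightarrow> c \<le> V e + int j))"

lemma bounded_by_down:
  assumes "bounded_by k c V p" "hop n k (i, i - 1) p p'"
  shows "bounded_by k c V p'"
  unfolding bounded_by_def
proof (intro allI impI)
  fix j e assume j: "j < k" "j < e" "e \<le> p' j"
  then have "p' j \<le> p j" using assms(2) by (auto simp: hop_def)
  then show "c \<le> V e + int j" using assms(1) j by (auto simp: bounded_by_def)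
qed

text \<open>Only the hop of a particle \<open>j\<close> over \<open>i\<close> needs an argument. If
  it has passed \<open>i - 1\<close> before, \<open>level\<close> transfers that bound to
  \<open>i\<close>. If it is still at its lowest site, either it is the last particle and
  \<open>last\<close> applies, or exclusion forces its successor to have passed \<open>i + 1\<close>
  already.\<close>

lemma bounded_by_up:
  assumes bd: "bounded_by k c V p" and hop: "hop n k (i - 1, i) p p'" and p: "config n k p"
    and lev: "level n V" and i: "1 \<le> i" "i < n" and last: "c \<le> V k + int k"
  shows "bounded_by k c (V(i := V i + 1)) p'"
  unfolding bounded_by_def
proof (intro allI impI)
  fix j e assume j: "j < k" "j < e" "e \<le> p' j"
  have p': "config n k p'" using hop by (simp add: hop_def)
  consider "p' j = p j" | "p j = i - 1" "p' j = i"
    using hop j by (auto simp: hop_def)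
  then show "c \<le> (V(i := V i + 1)) e + int j"
  proof cases
    case 1
    then have "c \<le> V e + int j" using bd j by (auto simp: bounded_by_def)
    then show ?thesis by (cases "e = i") auto
  next
    case 2
    show ?thesis
    proof (cases "e = i")
      case False
      then have "c \<le> V e + int j" using bd j 2 by (auto simp: bounded_by_def)
      then show ?thesis using False by simp
    next
      case True
      consider "j < i - 1" | "j = i - 1" "Suc j = k" | "j = i - 1" "Suc j < k"
        using j True by linarith
      then have "c \<le> V i + 1 + int j"
      proof cases
        case 1
        then have "c \<le> V (i - 1) + int j" using bd j 2 by (auto simp: bounded_by_def)
        moreover have "V (i - 1) \<le> V i + 1"
          using lev 1 i by (auto simp: level_def dest: spec[of _ "i - 1"])
        ultimately show ?thesis by simp
      next
        case 2
        \<comment> \<open>Here \<open>i = k\<close>, and the added use of \<open>i\<close> makes up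
          for \<open>j = k - 1\<close>.\<close>
        then show ?thesis using last i by simp
      next
        case 3
        have "p' j < p' (Suc j)" using config_less[OF p'] 3 by simp
        moreover have "p' (Suc j) = p (Suc j)"
          using hop 3 config_inj[OF p, of j "Suc j"] j \<open>p j = i - 1\<close> by (auto simp: hop_def)
        ultimately have "Suc i \<le> p (Suc j)" using \<open>p' j = i\<close> by simp
        then have "c \<le> V (Suc i) + int (Suc j)" "Suc i < n"
          using bd 3 i config_bound[OF p, of "Suc j"] by (auto simp: bounded_by_def)
        moreover have "V (Suc i) \<le> V i"
          using lev i calculation by (simp add: level_def)
        ultimately show ?thesis by simp
      qed
      then show ?thesis using True by simp
    qed
  qed
qed

text \<open>Using \<open>i\<close> changes only the threshold test at \<open>i\<close>, and only for
  the particle with \<open>c = V i + 1 + int j\<close>. If there is one, it waits at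
  \<open>i - 1\<close> with \<open>i\<close> free and hops; otherwise nothing moves.\<close>

lemma determined_by_up:
  assumes det: "determined_by n k c V p" and p: "config n k p" and "k \<le> n"
    and lev: "level n V" and lev': "level n (V(i := V i + 1))" and i: "1 \<le> i" "i < n"
  shows "\<exists>p'. hop n k (i - 1, i) p p' \<and> determined_by n k c (V(i := V i + 1)) p'"
proof (cases "\<exists>j<k. j < i \<and> i \<le> n - k + j \<and> c = V i + 1 + int j")
  case False
  have "determined_by n k c (V(i := V i + 1)) p"
    unfolding determined_by_def
  proof (intro allI impI)
    fix j e assume j: "j < k" "j < e" "e \<le> n - k + j"
    then have "e = i \<longrightarrow> c \<noteq> V i + 1 + int j" using False by blast
    moreover have "e \<le> p j \<longleftrightarrow> c \<le> V e + int j" using det j by (simp add: determined_by_def)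
    ultimately show "e \<le> p j \<longleftrightarrow> c \<le> (V(i := V i + 1)) e + int j" by auto
  qed
  then show ?thesis using hop_refl[OF p] by blast
next
  case True
  then obtain j where j: "j < k" "j < i" "i \<le> n - k + j" "c = V i + 1 + int j" by blast
  have iff: "e \<le> p l \<longleftrightarrow> c \<le> V e + int l" if "l < k" "l < e" "e \<le> n - k + l" for e l
    using det that by (simp add: determined_by_def)
  \<comment> \<open>The level condition after the use of \<open>i\<close> gives
    \<open>V i + 1 \<le> V (i - 1)\<close>, so particle \<open>j\<close> has met the threshold at
    \<open>i - 1\<close>.\<close>
  have prev: "c \<le> V (i - 1) + int j" if "j < i - 1"
  proof -
    have "1 \<le> i - 1" "Suc (i - 1) < n" "i \<noteq> i - 1" "Suc (i - 1) = i" using that i by simp_all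
    then have "V i + 1 \<le> V (i - 1)"
      using lev'[unfolded level_def, rule_format, of "i - 1"] by simp
    then show ?thesis using j by simp
  qed
  have "p j < i" using iff[OF j(1,2,3)] j(4) by simp
  moreover have "i - 1 \<le> p j"
    using config_ge_bottom[OF p j(1)] prev iff[of j "i - 1"] j by (cases "j < i - 1") auto
  ultimately have pj: "p j = i - 1" by simp
  \<comment> \<open>The same condition gives \<open>V i \<le> V (Suc i)\<close>; the successor of
    \<open>j\<close> has therefore passed \<open>Suc i\<close>, which keeps site \<open>i\<close>
    free.\<close>
  have beyond: "i < p l" if l: "j < l" "l < k" for l
  proof -
    have si: "Suc i < n" using j l assms(3) by linarith
    have "V i + 1 \<le> V (Suc i) + 1" using lev'[unfolded level_def, rule_format, OF i(1) si] by simp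
    then have "Suc i \<le> p (Suc j)" using iff[of "Suc j" "Suc i"] j l by simp
    also have "p (Suc j) \<le> p l"
      using config_less[OF p, of "Suc j" l] l by (cases "Suc j = l") auto
    finally show ?thesis by simp
  qed
  have free: "i \<notin> p ` {..<k}"
  proof
    assume "i \<in> p ` {..<k}"
    then obtain l where l: "l < k" "p l = i" by auto
    then have "j < l"
      using \<open>p j < i\<close> config_less[OF p, of l j] j(1) by (cases l j rule: linorder_cases) auto
    then show False using beyond l by force
  qed
  have "config n k (p(j := i))"
    using config_hop[OF p, of j i] free j i pj by (simp add: adjacent_def)
  then have "hop n k (i - 1, i) p (p(j := i))" using pj by (simp add: hop_def)
  moreover have "determined_by n k c (V(i := V i + 1)) (p(j := i))"
    unfolding determined_by_def
  proof (intro allI impI)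
    fix l e assume l: "l < k" "l < e" "e \<le> n - k + l"
    show "e \<le> (p(j := i)) l \<longleftrightarrow> c \<le> (V(i := V i + 1)) e + int l"
    proof (cases "l = j")
      case False
      then show ?thesis using iff[OF l] j(4) by auto
    next
      case True
      consider "e < i" | "e = i" | "i < e" by linarith
      then show ?thesis
      proof cases
        case 1
        then show ?thesis using iff[OF l] True pj by auto
      next
        case 2
        then show ?thesis using True j by simp
      next
        case 3
        then show ?thesis using iff[OF l] True pj by auto
      qed
    qed
  qed
  ultimately show ?thesis by blast
qed

lemma orders_split:
  assumes "orders n g (xs @ i # ys)"
  shows "i \<notin> set xs" "1 \<le> i" "i < n"
proof -
  show "i \<notin> set xs"
    using assms unfolding orders_def sorted_wrt_append by auto
  have "i \<in> {1..<n}" using assms unfolding orders_def by (metis in_set_conv_decomp)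
  then show "1 \<le> i" "i < n" by simp_all
qed

text \<open>The threshold \<open>int k - g k\<close> is the value that the last particle,
  \<open>k - 1\<close>, meets at index \<open>k\<close> upon the first use of that index. With
  \<open>0 \<le> m\<close> it fulfils the assumption \<open>last\<close> of the single-hop
  lemma.\<close>

lemma bounded_by_pass:
  assumes "unit_increments n g" "orders n g (xs @ ys)" "0 \<le> m" "k < n"
    and "path n k (up_moves ys) p q" "config n k p"
    and "bounded_by k (int k - g k) (height g m xs) p"
  shows "bounded_by k (int k - g k) (height g m (xs @ ys)) q"
  using assms(2,5-)
proof (induction ys arbitrary: xs p)
  case Nil
  then show ?case by (auto simp: up_moves_def bounded_by_def)
next
  case (Cons i ys)
  obtain p' where p': "hop n k (i - 1, i) p p'" "path n k (up_moves ys) p' q"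
    using Cons.prems(2) by (auto simp: up_moves_def)
  have ord: "orders n g ((xs @ [i]) @ ys)" using Cons.prems(1) by simp
  note new = orders_split(1)[OF Cons.prems(1)] and i = orders_split(2,3)[OF Cons.prems(1)]
  have "bounded_by k (int k - g k) (height g m (xs @ [i])) p'"
    unfolding height_snoc[OF new]
    by (rule bounded_by_up[OF Cons.prems(4) p'(1) Cons.prems(3) level_height[OF assms(1) Cons.prems(1)] i])
      (use assms(3) in \<open>simp add: height_def\<close>)
  moreover have "config n k p'" using p'(1) by (simp add: hop_def)
  ultimately have "bounded_by k (int k - g k) (height g m ((xs @ [i]) @ ys)) q"
    using Cons.IH[OF ord p'(2)] by blast
  then show ?case by simp
qed

lemma determined_by_pass:
  assumes "unit_increments n g" "orders n g (xs @ ys)" "k < n" "config n k p"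
    and "determined_by n k c (height g m xs) p"
  shows "\<exists>q. path n k (up_moves ys) p q \<and> determined_by n k c (height g m (xs @ ys)) q"
  using assms(2,4-)
proof (induction ys arbitrary: xs p)
  case Nil
  then show ?case by (auto simp: up_moves_def)
next
  case (Cons i ys)
  have ord: "orders n g ((xs @ [i]) @ ys)" using Cons.prems(1) by simp
  note new = orders_split(1)[OF Cons.prems(1)] and i = orders_split(2,3)[OF Cons.prems(1)]
  obtain p' where p': "hop n k (i - 1, i) p p'" "determined_by n k c (height g m (xs @ [i])) p'"
    using determined_by_up[OF Cons.prems(3,2) _ level_height[OF assms(1) Cons.prems(1)] _ i]
      level_height[OF assms(1) ord] assms(3)
    unfolding height_snoc[OF new] by auto
  moreover have "config n k p'" using p'(1) by (simp add: hop_def)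
  ultimately obtain q where "path n k (up_moves ys) p' q"
      "determined_by n k c (height g m ((xs @ [i]) @ ys)) q"
    using Cons.IH[OF ord] by blast
  then show ?case using p'(1) by (auto simp: up_moves_def)
qed

text \<open>A full pass uses every index once, so its list can be traded for one more completed
  pass. This holds only for indices from 1 to \<open>n - 1\<close>, whence the two congruence lemmas
  that follow.\<close>

lemma height_all:
  assumes "orders n g u" "1 \<le> e" "e < n"
  shows "height g m u e = height g (m + 1) [] e"
  using assms by (auto simp: height_def orders_def)

lemma bounded_by_cong:
  assumes "config n k p" "\<And>e. 1 \<le> e \<Longrightarrow> e < n \<Longrightarrow> V e = V' e" "bounded_by k c V p"
  shows "bounded_by k c V' p"
  unfolding bounded_by_def
proof (intro allI impI)
  fix j e assume j: "j < k" "j < e" "e \<le> p j"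
  then have "1 \<le> e" "e < n" using config_bound[OF assms(1) j(1)] by auto
  then show "c \<le> V' e + int j"
    using assms(2)[of e] assms(3)[unfolded bounded_by_def, rule_format, OF j] by simp
qed

lemma determined_by_cong:
  assumes "k < n" "\<And>e. 1 \<le> e \<Longrightarrow> e < n \<Longrightarrow> V e = V' e" "determined_by n k c V p"
  shows "determined_by n k c V' p"
  unfolding determined_by_def
proof (intro allI impI)
  fix j e assume j: "j < k" "j < e" "e \<le> n - k + j"
  then have "1 \<le> e" "e < n" using assms(1) by auto
  then show "e \<le> p j \<longleftrightarrow> c \<le> V' e + int j"
    using assms(2)[of e] assms(3)[unfolded determined_by_def, rule_format, OF j] by simp
qed

lemma bounded_by_down_moves:
  "path n k (down_moves v) p q \<Longrightarrow> bounded_by k c V p \<Longrightarrow> bounded_by k c V q"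
proof (induction v arbitrary: q)
  case Nil
  then show ?case by (auto simp: down_moves_def bounded_by_def)
next
  case (Cons i v)
  then obtain p' p'' where "path n k (down_moves v) p p'" "hop n k (i, i - 1) p' p''" "\<forall>j<k. p'' j = q j"
    by (auto simp: down_moves_def path_append)
  then have "bounded_by k c V p''"
    using Cons bounded_by_down by blast
  with \<open>\<forall>j<k. p'' j = q j\<close> show ?case by (simp add: bounded_by_def)
qed

lemma period_power_Suc:
  "period_power (Suc m) v u = down_moves v @ up_moves u @ period_power m v u"
  by (simp add: period_power_def)

lemma bounded_by_period_power:
  assumes "unit_increments n g" "orders n g u" "0 \<le> l" "k < n"
    and "path n k (period_power m v u) p q" "config n k p"
    and "bounded_by k (int k - g k) (height g l []) p"
  shows "bounded_by k (int k - g k) (height g (l + int m) []) q"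
  using assms(3,5-)
proof (induction m arbitrary: l p)
  case 0
  then show ?case by (auto simp: period_power_def bounded_by_def)
next
  case (Suc m)
  then obtain p1 p2 where p: "path n k (down_moves v) p p1" "path n k (up_moves u) p1 p2"
      "path n k (period_power m v u) p2 q"
    by (auto simp: period_power_Suc path_append)
  have c1: "config n k p1" and c2: "config n k p2"
    using p path_config Suc.prems(3) by blast+
  have "bounded_by k (int k - g k) (height g l []) p1"
    using bounded_by_down_moves[OF p(1) Suc.prems(4)] .
  then have "bounded_by k (int k - g k) (height g l u) p2"
    using bounded_by_pass[OF assms(1) _ Suc.prems(1) assms(4) p(2) c1, of "[]"] assms(2) by simp
  then have "bounded_by k (int k - g k) (height g (l + 1) []) p2"
    using bounded_by_cong[OF c2, of "height g l u"] height_all[OF assms(2)] by blast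
  then show ?case
    using Suc.IH[of "l + 1", OF _ p(3) c2] Suc.prems(1) by (simp add: algebra_simps)
qed

lemma determined_by_period_power:
  assumes "unit_increments n g" "orders n g u" "k < n" "config n k p"
    and "determined_by n k c (height g l []) p"
  shows "\<exists>q. path n k (period_power m v u) p q \<and> determined_by n k c (height g (l + int m) []) q"
  using assms(4-)
proof (induction m arbitrary: l p)
  case 0
  then show ?case by (auto simp: period_power_def)
next
  case (Suc m)
  obtain p' where p': "path n k (up_moves u) p p'" "determined_by n k c (height g l u) p'"
    using determined_by_pass[OF assms(1) _ assms(3) Suc.prems, of u] assms(2) by auto
  have "determined_by n k c (height g (l + 1) []) p'"
    using determined_by_cong[OF assms(3), of "height g l u"] height_all[OF assms(2)] p'(2) by blast
  then obtain q where q: "path n k (period_power m v u) p' q"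
      "determined_by n k c (height g (l + 1 + int m) []) q"
    using Suc.IH path_config[OF p'(1) Suc.prems(1)] by blast
  \<comment> \<open>All downward moves are declined.\<close>
  have "path n k (period_power (Suc m) v u) p q"
    using path_refl[OF Suc.prems(1)] p'(1) q(1) by (auto simp: period_power_Suc path_append)
  moreover have "l + 1 + int m = l + int (Suc m)" by simp
  ultimately show ?case using q(2) by metis
qed

section \<open>Number of periods needed between the extreme configurations\<close>

theorem path_bottom_top_iff:
  assumes g: "unit_increments n g" and u: "orders n g u" and k: "1 \<le> k" "k < n"
  shows "path n k (period_power m v u) (\<lambda>j. j) (\<lambda>j. n - k + j) \<longleftrightarrow>
    int k + g (n - k) - g k \<le> int m"
proof
  assume path: "path n k (period_power m v u) (\<lambda>j. j) (\<lambda>j. n - k + j)"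
  have "bounded_by k (int k - g k) (height g (0 + int m) []) (\<lambda>j. n - k + j)"
    by (rule bounded_by_period_power[OF g u _ k(2) path config_bottom])
      (use k in \<open>auto simp: bounded_by_def\<close>)
  \<comment> \<open>The bottleneck is the lowest particle, \<open>j = 0\<close>, which must pass
    \<open>n - k\<close>.\<close>
  then have "int k - g k \<le> height g (0 + int m) [] (n - k) + int 0"
    by (rule bounded_by_def[THEN iffD1, rule_format]) (use k in simp_all)
  then show "int k + g (n - k) - g k \<le> int m" by (simp add: height_def)
next
  assume m: "int k + g (n - k) - g k \<le> int m"
  have "determined_by n k (int k - g k) (height g 0 []) (\<lambda>j. j)"
    unfolding determined_by_def
  proof (intro allI impI)
    fix j e assume j: "j < k" "j < e" "e \<le> n - k + j"
    \<comment> \<open>At the start no particle has met a threshold above its lowest site.\<close>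
    have "g k - g e < int k - int j"
    proof (cases "e \<le> k")
      case True
      then show ?thesis using unit_incrementsD[OF g, of e k] j k by (simp add: of_nat_diff)
    next
      case False
      have "e < n" using j k by linarith
      then show ?thesis using unit_incrementsD[OF g, of k e] False j k by simp
    qed
    then show "e \<le> j \<longleftrightarrow> int k - g k \<le> height g 0 [] e + int j"
      using j by (simp add: height_def)
  qed
  then obtain q where q: "path n k (period_power m v u) (\<lambda>j. j) q"
      "determined_by n k (int k - g k) (height g (0 + int m) []) q"
    using determined_by_period_power[OF g u k(2) config_bottom] k by (meson less_imp_le)
  have "q j = n - k + j" if "j < k" for j
  proof -
    \<comment> \<open>Hence particle \<open>j\<close> meets its threshold at
      \<open>n - k + j\<close> no later than particle 0 does at \<open>n - k\<close>.\<close>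
    have "g (n - k + j) \<le> g (n - k) + int j"
      using unit_incrementsD[OF g, of "n - k" "n - k + j"] that k by simp
    then have "n - k + j \<le> q j"
      using q(2) that k m by (simp add: determined_by_def height_def)
    moreover have "q j + k \<le> n + j"
      using config_le_top[OF path_config[OF q(1) config_bottom] that] k by simp
    ultimately show ?thesis using k by simp
  qed
  then show "path n k (period_power m v u) (\<lambda>j. j) (\<lambda>j. n - k + j)"
    using path_cong_target[OF q(1)] by blast
qed

text \<open>The two extreme passages suffice, and time reversal turns the downward one into an
  upward one with \<open>u\<close> and \<open>v\<close> exchanged.\<close>

theorem all_paths_iff:
  assumes g: "unit_increments n g" "orders n g u" and h: "unit_increments n h" "orders n h v"
    and k: "1 \<le> k" "k < n"
  shows "(\<forall>p q. config n k p \<longrightarrow> config n k q \<longrightarrow> path n k (period_power m v u) p q) \<longleftrightarrow>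
    max (int k + g (n - k) - g k) (int k + h (n - k) - h k) \<le> int m"
proof -
  have bot: "config n k (\<lambda>j. j)" and top: "config n k (\<lambda>j. n - k + j)"
    by (rule config_bottom config_top; use k in simp)+
  have "path n k (period_power m v u) (\<lambda>j. n - k + j) (\<lambda>j. j) \<longleftrightarrow>
      path n k (period_power m u v) (\<lambda>j. j) (\<lambda>j. n - k + j)"
    using path_rev[OF top, of "period_power m v u"] path_rev[OF bot, of "period_power m u v"]
    unfolding period_power_rev by blast
  moreover have "\<forall>mv\<in>set (period_power m v u). adjacent n mv"
    using period_power_adjacent[of u n v] g(2) h(2) unfolding orders_def by blast
  ultimately have "(\<forall>p q. config n k p \<longrightarrow> config n k q \<longrightarrow> path n k (period_power m v u) p q) \<longleftrightarrow>
      path n k (period_power m v u) (\<lambda>j. j) (\<lambda>j. n - k + j) \<and>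
      path n k (period_power m u v) (\<lambda>j. j) (\<lambda>j. n - k + j)"
    using path_if_extreme_paths bot top by blast
  then show ?thesis
    unfolding path_bottom_top_iff[OF g k] path_bottom_top_iff[OF h k] by simp
qed

section \<open>Bidiagonal factors and their move words\<close>

lemma elem_bidiag_eq_addrow_mat:
  "1 \<le> i \<Longrightarrow> elem_bidiag n i a = addrow_mat n a (i - 1) i"
  by (rule eq_matI) (auto simp: elem_bidiag_def)

lemma elem_bidiag_zero: "elem_bidiag n i 0 = 1\<^sub>m n"
  by (rule eq_matI) (auto simp: elem_bidiag_def)

lemma elem_bidiag_carrier: "elem_bidiag n i a \<in> carrier_mat n n"
  by (simp add: elem_bidiag_def)

lemma transpose_addrow_mat: "transpose_mat (addrow_mat n a r s) = addrow_mat n a s r"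
  by (rule eq_matI) auto

lemma represents_elem_bidiag:
  assumes "represents n M w" "1 \<le> i" "i < n" "0 \<le> a"
  shows "represents n (elem_bidiag n i a * M) ((if 0 < a then [(i - 1, i)] else []) @ w)"
    and "represents n (transpose_mat (elem_bidiag n i a) * M) ((if 0 < a then [(i, i - 1)] else []) @ w)"
proof -
  note M = represents_carrier[OF assms(1)]
  have adj: "adjacent n (i - 1, i)" "adjacent n (i, i - 1)"
    using assms by (auto simp: adjacent_def)
  show "represents n (elem_bidiag n i a * M) ((if 0 < a then [(i - 1, i)] else []) @ w)"
    and "represents n (transpose_mat (elem_bidiag n i a) * M) ((if 0 < a then [(i, i - 1)] else []) @ w)"
    using assms represents_addrow[OF assms(1) adj(1)] represents_addrow[OF assms(1) adj(2)]
      elem_bidiag_zero[of n i] M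
    by (cases "a = 0"; simp add: elem_bidiag_eq_addrow_mat transpose_addrow_mat)+
qed

text \<open>\<open>factor_product\<close> for an arbitrary list of positions, as induction
  requires.\<close>

definition bidiag_product :: "nat \<Rightarrow> (nat \<Rightarrow> nat \<Rightarrow> real) \<Rightarrow> (nat \<times> nat) list \<Rightarrow> real mat" where
  "bidiag_product n a xs = foldr (\<lambda>(s, i) M. elem_bidiag n i (a s i) * M) xs (1\<^sub>m n)"

definition positive_indices :: "(nat \<Rightarrow> nat \<Rightarrow> real) \<Rightarrow> (nat \<times> nat) list \<Rightarrow> nat list" where
  "positive_indices a xs = map snd (filter (\<lambda>(s, i). 0 < a s i) xs)"

lemma bidiag_product_carrier: "bidiag_product n a xs \<in> carrier_mat n n"
  by (induction xs) (auto simp: bidiag_product_def intro!: mult_carrier_mat elem_bidiag_carrier)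

lemma bidiag_product_Cons:
  "bidiag_product n a ((s, i) # xs) = elem_bidiag n i (a s i) * bidiag_product n a xs"
  by (simp add: bidiag_product_def)

lemma represents_bidiag_product:
  assumes "represents n M w" "\<forall>(s, i)\<in>set xs. 1 \<le> i \<and> i < n \<and> 0 \<le> a s i"
  shows "represents n (bidiag_product n a xs * M) (up_moves (positive_indices a xs) @ w)"
  using assms(2)
proof (induction xs)
  case Nil
  then show ?case
    using assms(1) left_mult_one_mat[OF represents_carrier[OF assms(1)]]
    by (simp add: bidiag_product_def positive_indices_def up_moves_def)
next
  case (Cons x xs)
  obtain s i where x: "x = (s, i)" by force
  note M = represents_carrier[OF assms(1)]
  have i: "1 \<le> i" "i < n" "0 \<le> a s i" using Cons.prems x by auto
  have "bidiag_product n a (x # xs) * M = elem_bidiag n i (a s i) * (bidiag_product n a xs * M)"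
    unfolding x bidiag_product_Cons
    by (rule assoc_mult_mat[OF elem_bidiag_carrier bidiag_product_carrier M])
  then show ?case
    using represents_elem_bidiag(1)[OF Cons.IH i] Cons.prems
    by (auto simp: x positive_indices_def up_moves_def)
qed

text \<open>Transposition puts the first factor next to \<open>M\<close>; the induction absorbs it
  there and so generalises over \<open>M\<close> and \<open>w\<close>.\<close>

lemma represents_transpose_bidiag_product:
  assumes "represents n M w" "\<forall>(s, i)\<in>set xs. 1 \<le> i \<and> i < n \<and> 0 \<le> a s i"
  shows "represents n (transpose_mat (bidiag_product n a xs) * M)
    (down_moves (positive_indices a xs) @ w)"
  using assms
proof (induction xs arbitrary: M w)
  case Nil
  then show ?case
    using left_mult_one_mat[OF represents_carrier[OF Nil(1)]]
    by (simp add: bidiag_product_def positive_indices_def down_moves_def)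
next
  case (Cons x xs)
  obtain s i where x: "x = (s, i)" by force
  note M = represents_carrier[OF Cons.prems(1)]
  have i: "1 \<le> i" "i < n" "0 \<le> a s i" using Cons.prems x by auto
  have "transpose_mat (bidiag_product n a (x # xs)) * M =
      transpose_mat (bidiag_product n a xs) * (transpose_mat (elem_bidiag n i (a s i)) * M)"
    unfolding x bidiag_product_Cons
      transpose_mult[OF elem_bidiag_carrier bidiag_product_carrier]
    by (rule assoc_mult_mat[of _ n n _ n _ n])
      (simp_all add: elem_bidiag_carrier bidiag_product_carrier M)
  then show ?case
    using Cons.IH[OF represents_elem_bidiag(2)[OF Cons.prems(1) i]] Cons.prems
    by (auto simp: x positive_indices_def down_moves_def)
qed

lemma set_factor_positions: "set (factor_positions n) = {(s, i). 1 \<le> s \<and> s \<le> i \<and> i < n}"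
proof -
  have "(s, i) \<in> set (factor_positions n) \<longleftrightarrow> 1 \<le> s \<and> s \<le> i \<and> i < n" for s i
    by (auto simp: factor_positions_def image_iff intro!: bexI[of _ s])
  then show ?thesis by auto
qed

lemma sorted_factor_positions:
  "sorted_wrt (\<lambda>(s, i) (t, j). t < s \<or> s = t \<and> i < j) (factor_positions n)"
proof -
  have block: "sorted_wrt (\<lambda>(s, i) (t, j). t < s \<or> s = t \<and> i < j) (map (Pair s) [s..<n])" for s
    by (simp add: sorted_wrt_map)
  have "sorted_wrt (\<lambda>(s, i) (t, j). t < s \<or> s = t \<and> i < j)
      (concat (map (\<lambda>s. map (Pair s) [s..<n]) ss))" if "sorted_wrt (>) ss" for ss
    using that
  proof (induction ss)
    case (Cons s ss)
    then show ?case using block[of s] by (auto simp: sorted_wrt_append)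
  qed simp
  moreover have "sorted_wrt (>) (rev [1..<n])"
    by (simp add: sorted_wrt_rev)
  ultimately show ?thesis by (simp add: factor_positions_def)
qed

text \<open>Index \<open>i\<close> has its positive parameter in block \<open>s i\<close>. Blocks
  with larger start come first and each block is increasing, so \<open>i\<close> precedes
  \<open>i + 1\<close> exactly if \<open>s (Suc i) \<le> s i\<close>.\<close>

lemma orders_positive_indices:
  assumes s: "\<And>t i. 1 \<le> t \<Longrightarrow> t \<le> i \<Longrightarrow> i < n \<Longrightarrow> 0 < a t i \<longleftrightarrow> t = s i"
    and range: "\<And>i. 1 \<le> i \<Longrightarrow> i < n \<Longrightarrow> 1 \<le> s i \<and> s i \<le> i"
    and g: "\<And>i. 1 \<le> i \<Longrightarrow> Suc i < n \<Longrightarrow> g (Suc i) = g i + (if s (Suc i) \<le> s i then 0 else 1)"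
  shows "orders n g (positive_indices a (factor_positions n))"
proof -
  let ?xs = "filter (\<lambda>(s, i). 0 < a s i) (factor_positions n)"
  have set: "set ?xs = (\<lambda>i. (s i, i)) ` {1..<n}"
    using s range by (fastforce simp: set_factor_positions)
  show ?thesis
    unfolding orders_def positive_indices_def
  proof
    show "set (map snd ?xs) = {1..<n}"
      unfolding set_map set by force
    show "sorted_wrt (\<lambda>x y. x \<noteq> y \<and> (y = Suc x \<longrightarrow> g y = g x) \<and> (x = Suc y \<longrightarrow> g x = g y + 1)) (map snd ?xs)"
    proof (rule sorted_wrt_map_mono[OF sorted_wrt_filter[OF sorted_factor_positions]])
      fix x y
      assume "x \<in> set ?xs" "y \<in> set ?xs" and lt: "(\<lambda>(s, i) (t, j). t < s \<or> s = t \<and> i < j) x y"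
      then obtain i j where x: "x = (s i, i)" "1 \<le> i" "i < n" and y: "y = (s j, j)" "1 \<le> j" "j < n"
        unfolding set by auto
      have lt: "s j < s i \<or> s i = s j \<and> i < j" using lt x y by simp
      then show "snd x \<noteq> snd y \<and> (snd y = Suc (snd x) \<longrightarrow> g (snd y) = g (snd x)) \<and>
          (snd x = Suc (snd y) \<longrightarrow> g (snd x) = g (snd y) + 1)"
        using g[of i] g[of j] x y by auto
    qed
  qed
qed

lemma basic_params_orders:
  assumes "basic_params n a"
  obtains g where "unit_increments n g" "orders n g (positive_indices a (factor_positions n))"
proof -
  have ex1: "\<exists>!s. (1 \<le> s \<and> s \<le> i \<and> i < n) \<and> 0 < a s i" if "1 \<le> i" "i < n" for i
    using assms that by (simp add: basic_params_def set_factor_positions)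
  define s where "s i = (THE s. (1 \<le> s \<and> s \<le> i \<and> i < n) \<and> 0 < a s i)" for i
  have s: "(1 \<le> s i \<and> s i \<le> i \<and> i < n) \<and> 0 < a (s i) i" if "1 \<le> i" "i < n" for i
    unfolding s_def by (rule theI'[OF ex1[OF that]])
  \<comment> \<open>\<open>g e\<close> counts the \<open>i < e\<close> for which
    \<open>i + 1\<close> comes before \<open>i\<close>.\<close>
  define g where "g e = (\<Sum>i = 1..<e. if s (Suc i) \<le> s i then 0 else 1 :: int)" for e
  have g: "g (Suc e) = g e + (if s (Suc e) \<le> s e then 0 else 1)" if "1 \<le> e" for e
    using that by (simp add: g_def)
  show thesis
  proof
    show "unit_increments n g"
      by (simp add: unit_increments_def g)
    show "orders n g (positive_indices a (factor_positions n))"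
    proof (rule orders_positive_indices[of n a s])
      show "0 < a t i \<longleftrightarrow> t = s i" if "1 \<le> t" "t \<le> i" "i < n" for t i
      proof -
        have i: "1 \<le> i" using that by simp
        show ?thesis using ex1[OF i that(3)] s[OF i that(3)] that by metis
      qed
    qed (use s g in auto)
  qed
qed

lemma represents_power:
  assumes step: "\<And>M w. represents n M w \<Longrightarrow>
      represents n (A * M) (down_moves v @ up_moves u @ w)"
    and A: "A \<in> carrier_mat n n"
  shows "represents n (A ^\<^sub>m m) (period_power m v u)"
proof -
  have "represents n (A ^\<^sub>m m * M) (period_power m v u @ w)" if "represents n M w" for M w
    using that
  proof (induction m arbitrary: M w)
    case 0
    then show ?case
      using left_mult_one_mat[OF represents_carrier[OF 0]] A by (simp add: period_power_def)
  next
    case (Suc m)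
    note M = represents_carrier[OF Suc.prems]
    have "A ^\<^sub>m Suc m * M = A ^\<^sub>m m * (A * M)"
      using A M by (simp add: assoc_mult_mat[of _ n n _ n _ n])
    moreover have "period_power (Suc m) v u @ w = period_power m v u @ (down_moves v @ up_moves u @ w)"
      unfolding period_power_def replicate_Suc replicate_append_same[symmetric] by simp
    ultimately show ?case using Suc.IH[OF step[OF Suc.prems]] by simp
  qed
  from this[OF represents_one] show ?thesis using A by simp
qed

section \<open>The sequences of passage times\<close>

definition rate :: "nat \<Rightarrow> (nat \<Rightarrow> int) \<Rightarrow> nat \<Rightarrow> int" where
  "rate n g k = int k + g (n - k) - g k"

text \<open>\<open>g (n - k) - g k\<close> lies between 0 and \<open>n - 2 k\<close>, taken as
  integers, so the rate lies between the minimum and the maximum of \<open>k\<close> and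
  \<open>n - k\<close>.\<close>

lemma rate_bounds:
  assumes "unit_increments n g" "1 \<le> k" "k < n"
  shows "1 \<le> rate n g k" "rate n g k \<le> int (max k (n - k))"
proof -
  have "int (min k (n - k)) \<le> rate n g k \<and> rate n g k \<le> int (max k (n - k))"
  proof (cases "k \<le> n - k")
    case True
    have "g k \<le> g (n - k)" "g (n - k) \<le> g k + (int (n - k) - int k)"
      using unit_incrementsD[OF assms(1,2) True] assms(2,3) True by (auto simp: of_nat_diff)
    then show ?thesis using True by (simp add: rate_def)
  next
    case False
    then have le: "n - k \<le> k" by simp
    have "g (n - k) \<le> g k" "g k \<le> g (n - k) + (int k - int (n - k))"
      using unit_incrementsD[OF assms(1) _ le assms(3)] assms(3) le by (auto simp: of_nat_diff)
    then show ?thesis using le by (simp add: rate_def)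
  qed
  moreover have "1 \<le> int (min k (n - k))" using assms(2,3) by simp
  ultimately show "1 \<le> rate n g k" "rate n g k \<le> int (max k (n - k))" by linarith+
qed

lemma rate_complement: "k < n \<Longrightarrow> rate n g k + rate n g (n - k) = int n"
  by (simp add: rate_def of_nat_diff)

text \<open>The difference is 1 minus two increments of \<open>g\<close>, each of which is 0 or
  1.\<close>

lemma rate_Suc:
  assumes "unit_increments n g" "1 \<le> k" "k < n - 1"
  shows "\<bar>rate n g (k + 1) - rate n g k\<bar> \<le> 1"
proof -
  have step: "g e \<le> g (e + 1) \<and> g (e + 1) \<le> g e + 1" if "1 \<le> e" "e + 1 < n" for e
    using assms(1) that by (simp add: unit_increments_def)
  have "n - (k + 1) + 1 = n - k" using assms by simp
  then have "g (n - (k + 1)) \<le> g (n - k) \<and> g (n - k) \<le> g (n - (k + 1)) + 1"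
    using step[of "n - (k + 1)"] assms by simp
  moreover have "g k \<le> g (k + 1) \<and> g (k + 1) \<le> g k + 1"
    using step[of k] assms by simp
  ultimately show ?thesis unfolding rate_def by linarith
qed

text \<open>By \<open>sym\<close>, \<open>x k = k - r k\<close> is odd under
  \<open>k \<mapsto> n - k\<close>, and \<open>g\<close> is half of it, rounded down. Since
  \<open>x\<close> increases by 0, 1 or 2, \<open>g\<close> has unit increments; rounding is
  harmless because the floors of \<open>- x / 2\<close> and \<open>x / 2\<close> differ by exactly
  \<open>- x\<close>.\<close>

lemma rate_surj:
  fixes r :: "nat \<Rightarrow> int"
  assumes lip: "\<And>k. 1 \<le> k \<Longrightarrow> k < n - 1 \<Longrightarrow> \<bar>r (k + 1) - r k\<bar> \<le> 1"
    and sym: "\<And>k. 1 \<le> k \<Longrightarrow> k < n \<Longrightarrow> r k + r (n - k) = int n"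
  obtains g where "unit_increments n g" "\<And>k. 1 \<le> k \<Longrightarrow> k < n \<Longrightarrow> rate n g k = r k"
proof
  let ?g = "\<lambda>k. (int k - r k) div 2"
  show "unit_increments n ?g"
    unfolding unit_increments_def
  proof (intro allI impI)
    fix e assume "1 \<le> e" "Suc e < n"
    then have "\<bar>r (Suc e) - r e\<bar> \<le> 1" using lip[of e] by simp
    moreover have "int (Suc e) = int e + 1" by simp
    ultimately show "?g e \<le> ?g (Suc e) \<and> ?g (Suc e) \<le> ?g e + 1" by linarith
  qed
  show "rate n ?g k = r k" if "1 \<le> k" "k < n" for k
  proof -
    have "int (n - k) - r (n - k) = - (int k - r k)" using sym[OF that] that by simp
    moreover have "- x div 2 - x div 2 = - x" for x :: int by presburger
    ultimately show ?thesis unfolding rate_def by (simp add: algebra_simps)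
  qed
qed

section \<open>Exponents of basic oscillatory matrices\<close>

lemma basic_product_power:
  assumes a: "basic_params n a" and b: "basic_params n b" and d: "\<forall>i<n. 0 < d i"
    and A: "A = transpose_mat (factor_product n a) * mat_diag n d * factor_product n b"
  shows "A \<in> carrier_mat n n"
    and "represents n (A ^\<^sub>m m) (period_power m (positive_indices a (factor_positions n))
      (positive_indices b (factor_positions n)))"
proof -
  have fp: "factor_product n = (\<lambda>a. bidiag_product n a (factor_positions n))"
    by (simp add: fun_eq_iff factor_product_def bidiag_product_def)
  note car = bidiag_product_carrier[of n a "factor_positions n"]
    bidiag_product_carrier[of n b "factor_positions n"]
  have pos: "\<forall>(s, i)\<in>set (factor_positions n). 1 \<le> i \<and> i < n \<and> 0 \<le> a s i" if "basic_params n a" for a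
    using that by (auto simp: basic_params_def set_factor_positions)
  show carA: "A \<in> carrier_mat n n"
    unfolding A fp using car by (auto intro!: mult_carrier_mat)
  show "represents n (A ^\<^sub>m m) (period_power m (positive_indices a (factor_positions n))
      (positive_indices b (factor_positions n)))"
  proof (rule represents_power[OF _ carA])
    fix M w assume M: "represents n M w"
    note carM = represents_carrier[OF M]
    let ?L = "transpose_mat (factor_product n a)" and ?D = "mat_diag n d" and ?U = "factor_product n b"
    have L: "?L \<in> carrier_mat n n" and U: "?U \<in> carrier_mat n n" and D: "?D \<in> carrier_mat n n"
      using car by (simp_all add: fp)
    have "A * M = ?L * ?D * (?U * M)"
      unfolding A by (rule assoc_mult_mat[OF mult_carrier_mat[OF L D] U carM])
    also have "\<dots> = ?L * (?D * (?U * M))"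
      by (rule assoc_mult_mat[OF L D mult_carrier_mat[OF U carM]])
    finally show "represents n (A * M) (down_moves (positive_indices a (factor_positions n)) @
        up_moves (positive_indices b (factor_positions n)) @ w)"
      using represents_transpose_bidiag_product[OF
          represents_diag[OF represents_bidiag_product[OF M pos[OF b]]] pos[OF a]] d
      by (simp add: fp)
  qed
qed

text \<open>The admissible exponents form the up-set above the larger rate, so the infimum is that
  rate.\<close>

lemma minor_exponent_eq:
  assumes a: "basic_params n a" and b: "basic_params n b" and d: "\<forall>i<n. 0 < d i"
    and A: "A = transpose_mat (factor_product n a) * mat_diag n d * factor_product n b"
    and g: "unit_increments n g" "orders n g (positive_indices b (factor_positions n))"
    and h: "unit_increments n h" "orders n h (positive_indices a (factor_positions n))"
    and k: "1 \<le> k" "k < n"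
  shows "int (minor_exponent k A) = max (rate n g k) (rate n h k)"
proof -
  note rep = basic_product_power(2)[OF a b d A]
  have car: "A ^\<^sub>m m \<in> carrier_mat n n" for m
    by (rule represents_carrier[OF rep])
  have "(\<forall>x\<in>minors k (A ^\<^sub>m m). 0 < x) \<longleftrightarrow> max (rate n g k) (rate n h k) \<le> int m" for m
  proof -
    have "(\<forall>x\<in>minors k (A ^\<^sub>m m). 0 < x) \<longleftrightarrow>
        (\<forall>p q. config n k p \<longrightarrow> config n k q \<longrightarrow> 0 < seq_minor k (A ^\<^sub>m m) p q)"
      unfolding minors_eq[OF car] by blast
    also have "\<dots> \<longleftrightarrow> (\<forall>p q. config n k p \<longrightarrow> config n k q \<longrightarrow> path n k (period_power m
        (positive_indices a (factor_positions n)) (positive_indices b (factor_positions n))) p q)"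
      using rep by (simp add: represents_def cong: imp_cong)
    finally show ?thesis
      using all_paths_iff[OF g h k] by (simp add: rate_def)
  qed
  \<comment> \<open>This makes the requirement \<open>1 \<le> m\<close> in
    \<open>minor_exponent\<close> automatic.\<close>
  moreover have "1 \<le> max (rate n g k) (rate n h k)"
    using rate_bounds(1)[OF g(1) k] by simp
  ultimately have "{m. 1 \<le> m \<and> (\<forall>x\<in>minors k (A ^\<^sub>m m). 0 < x)} =
      {nat (max (rate n g k) (rate n h k))..}"
    by (auto simp: nat_le_iff)
  then show ?thesis
    unfolding minor_exponent_def using \<open>1 \<le> max _ _\<close> by simp
qed

text \<open>The representation by moves gives total nonnegativity, and the constant path makes the
  minor of order \<open>n\<close>, the determinant, positive.\<close>

lemma basic_oscillatoryI:
  assumes a: "basic_params n a" and b: "basic_params n b" and d: "\<forall>i<n. 0 < d i"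
    and A: "A = transpose_mat (factor_product n a) * mat_diag n d * factor_product n b"
  shows "basic_oscillatory n A"
proof -
  note car = basic_product_power(1)[OF a b d A]
  have rep: "represents n A (period_power 1 (positive_indices a (factor_positions n))
      (positive_indices b (factor_positions n)))"
    using basic_product_power(2)[OF a b d A, of 1] car by simp
  have "totally_nonneg A"
    using rep unfolding totally_nonneg_def minors_eq[OF car] by (auto simp: represents_def)
  moreover have "invertible_mat A"
  proof -
    have "config n n (\<lambda>j. j)" by (simp add: config_bottom)
    then have "0 < seq_minor n A (\<lambda>j. j) (\<lambda>j. j)"
      using rep path_refl unfolding represents_def by blast
    moreover have "mat n n (\<lambda>(i, j). A $$ (i, j)) = A"
      using car by (intro eq_matI) auto
    ultimately have "det A \<noteq> 0" by (simp add: seq_minor_def)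
    from det_non_zero_imp_unit[OF car this, of "()"] show ?thesis
      using car by (auto simp: Units_def ring_mat_def invertible_mat_def inverts_mat_def)
  qed
  ultimately show ?thesis using assms car by (auto simp: basic_oscillatory_def)
qed

lemma exists_basic_params:
  assumes g: "unit_increments n g"
  obtains a where "basic_params n a" "orders n g (positive_indices a (factor_positions n))"
proof
  \<comment> \<open>The block start rises by one exactly when \<open>g\<close> does, so blocks
    reproduce the order encoded by \<open>g\<close>; unit increments keep \<open>s i\<close> between
    1 and \<open>i\<close>.\<close>
  define s where "s i = nat (1 + g i - g 1)" for i
  let ?a = "\<lambda>t i. if t = s i then 1 else 0 :: real"
  have range: "1 \<le> s i \<and> s i \<le> i" if "1 \<le> i" "i < n" for i
    using unit_incrementsD[OF g _ that] that by (auto simp: s_def)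
  show "basic_params n ?a"
    using range by (auto simp: basic_params_def set_factor_positions)
  show "orders n g (positive_indices ?a (factor_positions n))"
  proof (rule orders_positive_indices[where s = s])
    fix i assume i: "1 \<le> i" "Suc i < n"
    have "g i \<le> g (Suc i)" "g (Suc i) \<le> g i + 1" "g 1 \<le> g i"
      using g i unit_incrementsD[OF g, of 1 i] by (auto simp: unit_increments_def)
    then show "g (Suc i) = g i + (if s (Suc i) \<le> s i then 0 else 1)"
      by (auto simp: s_def)
  qed (use range in auto)
qed

section \<open>The exponent vectors that occur\<close>

theorem theorem3p12:
  fixes n :: nat and f :: "nat \<Rightarrow> nat"
  assumes "n \<ge> 2"
    and "\<And>k. 1 \<le> k \<Longrightarrow> k < n \<Longrightarrow> 0 < f k"
  shows "(\<exists>A. basic_oscillatory n A \<and> (\<forall>k. 1 \<le> k \<and> k < n \<longrightarrow> minor_exponent k A = f k)) \<longleftrightarrow>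
    (\<forall>k. 1 \<le> k \<and> k < n \<longrightarrow> f k \<le> max k (n - k)) \<and>
    (\<forall>k. 1 \<le> k \<and> k < n - 1 \<longrightarrow> \<bar>int (f (k + 1)) - int (f k)\<bar> \<le> 1) \<and>
    (\<forall>k. 1 \<le> k \<and> k < n \<longrightarrow> n \<le> f k + f (n - k))"
proof
  assume "\<exists>A. basic_oscillatory n A \<and> (\<forall>k. 1 \<le> k \<and> k < n \<longrightarrow> minor_exponent k A = f k)"
  then obtain A a b d where A: "basic_params n a" "basic_params n b" "\<forall>i<n. 0 < d i"
      "A = transpose_mat (factor_product n a) * mat_diag n d * factor_product n b"
    and f: "\<And>k. 1 \<le> k \<Longrightarrow> k < n \<Longrightarrow> f k = minor_exponent k A"
    by (auto simp: basic_oscillatory_def)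
  obtain g where g: "unit_increments n g" "orders n g (positive_indices b (factor_positions n))"
    using basic_params_orders[OF A(2)] .
  obtain h where h: "unit_increments n h" "orders n h (positive_indices a (factor_positions n))"
    using basic_params_orders[OF A(1)] .
  have f: "int (f k) = max (rate n g k) (rate n h k)" if "1 \<le> k" "k < n" for k
    using minor_exponent_eq[OF A g h that] f[OF that] by simp
  have "f k \<le> max k (n - k)" if "1 \<le> k" "k < n" for k
    using rate_bounds(2)[OF g(1) that] rate_bounds(2)[OF h(1) that] f[OF that] by linarith
  moreover have "\<bar>int (f (k + 1)) - int (f k)\<bar> \<le> 1" if "1 \<le> k" "k < n - 1" for k
  proof -
    have "int (f k) = max (rate n g k) (rate n h k)"
      "int (f (k + 1)) = max (rate n g (k + 1)) (rate n h (k + 1))"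
      using f that by simp_all
    then show ?thesis using rate_Suc[OF g(1) that] rate_Suc[OF h(1) that] by linarith
  qed
  moreover have "n \<le> f k + f (n - k)" if "1 \<le> k" "k < n" for k
  proof -
    have "1 \<le> n - k" "n - k < n" using that by simp_all
    \<comment> \<open>Both values of \<open>f\<close> dominate the rates of \<open>g\<close>, which
      add up to \<open>n\<close>.\<close>
    then show ?thesis
      using f[OF that] f[of "n - k"] rate_complement[OF that(2), of g] by linarith
  qed
  ultimately show "(\<forall>k. 1 \<le> k \<and> k < n \<longrightarrow> f k \<le> max k (n - k)) \<and>
    (\<forall>k. 1 \<le> k \<and> k < n - 1 \<longrightarrow> \<bar>int (f (k + 1)) - int (f k)\<bar> \<le> 1) \<and>
    (\<forall>k. 1 \<le> k \<and> k < n \<longrightarrow> n \<le> f k + f (n - k))"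
    by blast
next
  assume "(\<forall>k. 1 \<le> k \<and> k < n \<longrightarrow> f k \<le> max k (n - k)) \<and>
    (\<forall>k. 1 \<le> k \<and> k < n - 1 \<longrightarrow> \<bar>int (f (k + 1)) - int (f k)\<bar> \<le> 1) \<and>
    (\<forall>k. 1 \<le> k \<and> k < n \<longrightarrow> n \<le> f k + f (n - k))"
  then have le: "\<And>k. 1 \<le> k \<Longrightarrow> k < n \<Longrightarrow> f k \<le> max k (n - k)"
    and lip: "\<And>k. 1 \<le> k \<Longrightarrow> k < n - 1 \<Longrightarrow> \<bar>int (f (k + 1)) - int (f k)\<bar> \<le> 1"
    and ge: "\<And>k. 1 \<le> k \<Longrightarrow> k < n \<Longrightarrow> n \<le> f k + f (n - k)"
    by blast+
  \<comment> \<open>Each half of \<open>f\<close> is continued to the other half by the only rule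
    compatible with complementary rates adding up to \<open>n\<close>.\<close>
  define r where "r k = (if 2 * k \<le> n then int (f k) else int n - int (f (n - k)))" for k
  define r' where "r' k = (if 2 * k < n then int n - int (f (n - k)) else int (f k))" for k
  \<comment> \<open>At the midpoint the upper bound and the sum condition leave a single value, so
    the two halves fit together.\<close>
  have half: "2 * f k = n" if "2 * k = n" for k
    using le[of k] ge[of k] that assms(1) by (auto simp: max_def)
  have lip': "\<bar>int (f (n - k)) - int (f (n - (k + 1)))\<bar> \<le> 1" if "1 \<le> k" "k < n - 1" for k
  proof -
    have "n - (k + 1) + 1 = n - k" using that by simp
    then show ?thesis using lip[of "n - (k + 1)"] that by simp
  qed
  \<comment> \<open>For \<open>n = 2 k + 1\<close> both middle values are at most
    \<open>k + 1\<close> and add up to at least \<open>n\<close>, so each is \<open>k\<close> or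
    \<open>k + 1\<close>.\<close>
  have mid: "\<bar>int n - 2 * int (f k)\<bar> \<le> 1" "\<bar>int n - 2 * int (f (k + 1))\<bar> \<le> 1"
    if "2 * k + 1 = n" "1 \<le> k" for k
  proof -
    have "n - k = k + 1" using that by simp
    then show "\<bar>int n - 2 * int (f k)\<bar> \<le> 1" "\<bar>int n - 2 * int (f (k + 1))\<bar> \<le> 1"
      using le[of k] le[of "k + 1"] ge[of k] that by (auto simp: max_def)
  qed
  have r_lip: "\<bar>r (k + 1) - r k\<bar> \<le> 1" and r'_lip: "\<bar>r' (k + 1) - r' k\<bar> \<le> 1"
    if k: "1 \<le> k" "k < n - 1" for k
  proof -
    \<comment> \<open>The cases locate \<open>n / 2\<close> relative to \<open>k\<close> and
      \<open>k + 1\<close>. If it equals one of them, only one of \<open>r\<close> and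
      \<open>r'\<close> changes branch; if it lies strictly between, both do.\<close>
    have "2 * (k + 1) < n \<or> 2 * (k + 1) = n \<or> 2 * k + 1 = n \<or> 2 * k = n \<or> 2 * k > n"
      by presburger
    then have "\<bar>r (k + 1) - r k\<bar> \<le> 1 \<and> \<bar>r' (k + 1) - r' k\<bar> \<le> 1"
    proof (elim disjE, goal_cases)
      case 1
      then show ?case using lip[OF k] lip'[OF k] by (simp add: r_def r'_def)
    next
      case 2
      then have "n - (k + 1) = k + 1" by simp
      then show ?case using lip[OF k] lip'[OF k] half[OF 2] 2 by (simp add: r_def r'_def)
    next
      case 3
      then have "n - k = k + 1" "n - (k + 1) = k" by simp_all
      then show ?case using mid[OF 3 k(1)] 3 by (simp add: r_def r'_def)
    next
      case 4
      then have "n - k = k" by simp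
      then show ?case using lip[OF k] lip'[OF k] half[OF 4] 4 by (simp add: r_def r'_def)
    next
      case 5
      then show ?case using lip[OF k] lip'[OF k] by (simp add: r_def r'_def)
    qed
    then show "\<bar>r (k + 1) - r k\<bar> \<le> 1" "\<bar>r' (k + 1) - r' k\<bar> \<le> 1" by simp_all
  qed
  have r_sym: "r k + r (n - k) = int n" "r' k + r' (n - k) = int n" if "1 \<le> k" "k < n" for k
  proof -
    consider "2 * k < n" | "2 * k = n" "n - k = k" | "2 * k > n" by arith
    then have "r k + r (n - k) = int n \<and> r' k + r' (n - k) = int n"
    proof cases
      case 2
      then show ?thesis using half[OF 2(1)] by (simp add: r_def r'_def)
    qed (use that in \<open>auto simp: r_def r'_def\<close>)
    then show "r k + r (n - k) = int n" "r' k + r' (n - k) = int n" by simp_all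
  qed
  obtain g where g: "unit_increments n g" "\<And>k. 1 \<le> k \<Longrightarrow> k < n \<Longrightarrow> rate n g k = r k"
    using rate_surj[of n r] r_lip r_sym by blast
  obtain h where h: "unit_increments n h" "\<And>k. 1 \<le> k \<Longrightarrow> k < n \<Longrightarrow> rate n h k = r' k"
    using rate_surj[of n r'] r'_lip r_sym by blast
  obtain b where b: "basic_params n b" "orders n g (positive_indices b (factor_positions n))"
    using exists_basic_params[OF g(1)] .
  obtain a where a: "basic_params n a" "orders n h (positive_indices a (factor_positions n))"
    using exists_basic_params[OF h(1)] .
  define A where "A = transpose_mat (factor_product n a) * mat_diag n (\<lambda>_. 1) * factor_product n b"
  have d: "\<forall>i<n. 0 < (\<lambda>_. 1 :: real) i" by simp
  have "minor_exponent k A = f k" if k: "1 \<le> k" "k < n" for k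
  proof -
    have "int (minor_exponent k A) = max (r k) (r' k)"
      using minor_exponent_eq[OF a(1) b(1) d A_def g(1) b(2) h(1) a(2) k] g(2)[OF k] h(2)[OF k] by simp
    \<comment> \<open>The sum condition says that the reflected value \<open>n - f (n - k)\<close>
      is at most \<open>f k\<close>.\<close>
    also have "\<dots> = int (f k)"
      using ge[OF k] by (auto simp: r_def r'_def max_def)
    finally show ?thesis by simp
  qed
  moreover have "basic_oscillatory n A"
    by (rule basic_oscillatoryI[OF a(1) b(1) d A_def])
  ultimately show "\<exists>A. basic_oscillatory n A \<and> (\<forall>k. 1 \<le> k \<and> k < n \<longrightarrow> minor_exponent k A = f k)"
    by blast
qed

end
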